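(* For each positive integer $d$, there is a constant $C=C_d>0$ such that the following holds. Let $0<p<1$, sample a $p$-random subset $A \subseteq \mathbb{Z}_{\geq 0}^d$, and set $S^*:=\mathrm{FS}(A)$. Then with high probability (as $p \to 0$), we have $$|S^* \cap \mathcal{R}_d(p,C^{-1} p^{-1}(\log p^{-1})^{d+1})|=o\big(|\mathcal{R}_d(p,C^{-1} p^{-1}(\log p^{-1})^{d+1})|\big)$$ and $$\mathbb{Z}_{\geq 0}^d \setminus \mathcal{R}_d(p,C p^{-1}(\log p^{-1})^{d+1}) \subseteq S^*,$$ and in particular the gap set has size $$|\mathbb{Z}_{\geq 0}^d \setminus S^*| \asymp_d p^{-1}(\log p^{-1})^{2d}.$$
   Context: A $p$-random subset of a set $X$ is a random subset in which each element of $X$ is included independently with probability $p$. For a subset $A$ of an abelian group, $\mathrm{FS}(A):=\{a_1+\cdots+a_k: k \in \mathbb{Z}_{\geq 0},\ a_1,\ldots,a_k \in A \text{ distinct}\}$ is the set of (finite) subset sums of $A$ (the empty sum $0$ is included). For $Z>0$, $$\mathcal{R}_d(p,Z):=\{(x_1, \ldots, x_d) \in \mathbb{Z}_{\geq 0}^d: (x_1+\log p^{-1}) \cdots (x_d+\log p^{-1})\leq Z\}.$$ Logarithms are natural. An event (depending on $p$) occurs with high probability if its probability tends to $1$ as $p \to 0$. The first conclusion means: there is a function $\delta(p)\to 0$ as $p\to 0$ such that with high probability the left-hand side is at most $\delta(p)$ times the size of the indicated region. The notation $f \asymp_d g$ means $c\,g \leq f \leq c' g$ for constants $c,c'>0$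 depending only on $d$; in the last conclusion, such constants exist so that the two inequalities hold with high probability. *)

theory Defs
  imports "HOL-Probability.Probability"
begin

definition subset_sums :: "'a::comm_monoid_add set \<Rightarrow> 'a set" where
  "subset_sums A = {\<Sum>a\<in>F. a | F. finite F \<and> F \<subseteq> A}"

definition region :: "real \<Rightarrow> real \<Rightarrow> (nat ^ 'd) set" where
  "region p Z = {x. (\<Prod>i\<in>UNIV. real (x $ i) + ln (1 / p)) \<le> Z}"

text \<open>
  A \<open>p\<close>-random subset of the ground type is encoded by independent coin flips \<open>\<omega> x\<close>,
  each true with probability \<open>p\<close>; the subset is \<open>{x. \<omega> x}\<close>. The parameter of
  \<^const>\<open>bernoulli_pmf\<close> is clipped to the unit interval, which is irrelevant for \<open>0 < p < 1\<close>.
\<close>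

definition coin_flips :: "real \<Rightarrow> ('a \<Rightarrow> bool) measure" where
  "coin_flips p = (\<Pi>\<^sub>M x\<in>UNIV. measure_pmf (bernoulli_pmf p))"

definition random_subset_prob :: "real \<Rightarrow> ('a set \<Rightarrow> bool) \<Rightarrow> real" where
  "random_subset_prob p E = measure (coin_flips p) {\<omega> \<in> space (coin_flips p). E {x. \<omega> x}}"

text \<open>
  Since a non-measurable set has \<^const>\<open>measure\<close> zero, the following also forces the
  events to be measurable for all sufficiently small \<open>p > 0\<close>.
\<close>

definition with_high_probability :: "(real \<Rightarrow> 'a set \<Rightarrow> bool) \<Rightarrow> bool" where
  "with_high_probability E \<longleftrightarrow> ((\<lambda>p. random_subset_prob p (E p)) \<longlongrightarrow> 1) (at_right 0)"

end

theory Submission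
  imports Defs "HOL-Real_Asymp.Real_Asymp"
begin

text \<open>
  Write \<open>L = ln (1 / p)\<close>, \<open>y(x) = (x\<^sub>1 + L) \<dots> (x\<^sub>d + L)\<close> and \<open>S\<close> for the set of subset sums of
  the random set \<open>A\<close>. The threshold \<open>y(x) \<approx> L\<^bsup>d+1\<^esup> / p\<close> is where about \<open>L\<close> summands become available:
  the box of vectors bounded by \<open>x / L\<close> has about \<open>y(x) / L\<^bsup>d\<^esup>\<close> points, hence about \<open>p y(x) / L\<^bsup>d\<^esup>\<close>
  random elements, and one needs about \<open>L\<close> of them for their \<open>2\<^bsup>L\<^esup>\<close> subset sums to outnumber \<open>1 / p\<close>.

  \<^bold>\<open>Above the threshold everything is covered.\<close> Fix \<open>x\<close> and put \<open>k \<approx> (p y(x))\<^bsup>1/(d+1)\<^esup>\<close>, up to a small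
  constant. Expose the elements of the box \<open>D = {a. a \<le> x / (2 k)}\<close> one at a time and maintain a set \<open>T\<close>
  of subset sums of exposed elements of \<open>A\<close>, starting from \<open>{0}\<close>. A translate
  \<open>a + T\<close> overlaps \<open>T\<close> in more than half of \<open>T\<close> for at most \<open>2 |T|\<close> vectors \<open>a\<close>, simply because a pair
  of elements of \<open>T\<close> determines \<open>a\<close> (\<open>exists_expanding_translate\<close>). So as long as \<open>|T|\<close> is much smaller
  than the unexposed part of \<open>D\<close>, one can choose to expose an \<open>a\<close> which, if it belongs to \<open>A\<close>, enlarges
  \<open>T\<close> by the factor \<open>3/2\<close>. The exposures are independent trials with success probability \<open>p\<close>, so with
  probability \<open>1 - exp (- \<Omega>(k))\<close> there are \<open>k\<close> successes and \<open>|T| \<ge> 2 k / p\<close>. All elements of \<open>T\<close> are at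
  most \<open>x / 2\<close>, so the \<open>|T|\<close> vectors \<open>x - s\<close> with \<open>s \<in> T\<close> lie outside \<open>D\<close> and have not been exposed;
  if one of them is in \<open>A\<close> then \<open>x\<close> is a subset sum, and all of them miss \<open>A\<close> only with probability
  \<open>(1 - p)\<^bsup>|T|\<^esup> \<le> exp (- 2 k)\<close>. Both stages are treated by one induction in \<open>adaptive_exposure\<close>. Since \<open>k\<close>
  grows like a power of \<open>y(x)\<close>, the failure probabilities are summable over all \<open>x\<close> above the threshold
  (\<open>covering_probability\<close>).

  \<^bold>\<open>Below the threshold almost nothing is covered.\<close> For a box \<open>{x. x \<le> c}\<close> the expected number of its
  points in \<open>S\<close> is at most the expected number of finite subsets of \<open>A\<close> whose sum lies in the box. Giving each
  subset \<open>F\<close> the exponential weight \<open>exp (t \<cdot> (c - \<Sum>F)) \<ge> 1\<close> bounds this by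
  \<open>exp (t \<cdot> c + p \<Prod>(1 + 1 / t\<^sub>i))\<close>; with \<open>t\<^sub>i\<close> proportional to \<open>L / (c\<^sub>i + L)\<close> the bound is \<open>p\<^bsup>-1/2\<^esup>\<close> when
  \<open>y(c)\<close> is a small multiple of \<open>L\<^bsup>d+1\<^esup> / p\<close> (\<open>expected_subset_sums_in_box_le_exp\<close>). Polylogarithmically many dyadic
  boxes cover the region, which itself has at least \<open>\<Omega>(1 / p)\<close> points, and Markov's inequality finishes
  (\<open>sparsity_probability\<close>).

  \<^bold>\<open>The gap set.\<close> It is contained in the larger region and contains most of the smaller one, and slicing
  along one coordinate shows that both have \<open>\<Theta>(L\<^bsup>2d\<^esup> / p)\<close> points (\<open>card_region_asymp\<close>).
\<close>

section \<open>Random subsets of a finite set\<close>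

text \<open>
  The probability that a \<open>p\<close>-random subset of the finite set \<open>U\<close> satisfies \<open>Ev\<close>. Being a finite sum, it allows
  one element of \<open>U\<close> to be revealed at a time by plain algebra.
\<close>

definition bernoulli_weight :: "real \<Rightarrow> 'a set \<Rightarrow> ('a set \<Rightarrow> bool) \<Rightarrow> real" where
  "bernoulli_weight p U Ev = (\<Sum>F\<in>Pow U. if Ev F then p ^ card F * (1 - p) ^ card (U - F) else 0)"

text \<open>
  Conditioning on whether \<open>a\<close> is in the random set.
\<close>

lemma bernoulli_weight_insert:
  assumes "finite U" "a \<notin> U"
  shows "bernoulli_weight p (insert a U) Ev =
    p * bernoulli_weight p U (\<lambda>F. Ev (insert a F)) + (1 - p) * bernoulli_weight p U Ev"
proof -
  let ?w = "\<lambda>U F. if Ev F then p ^ card F * (1 - p) ^ card (U - F) else 0"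
  have disj: "Pow U \<inter> insert a ` Pow U = {}" using assms by auto
  have inj: "inj_on (insert a) (Pow U)" using assms by (auto simp: inj_on_def)
  have "bernoulli_weight p (insert a U) Ev = sum (?w (insert a U)) (Pow U) + sum (?w (insert a U)) (insert a ` Pow U)"
    unfolding bernoulli_weight_def Pow_insert
    by (rule sum.union_disjoint) (use assms disj in auto)
  also have "sum (?w (insert a U)) (Pow U) = (1 - p) * bernoulli_weight p U Ev"
    unfolding bernoulli_weight_def sum_distrib_left
  proof (rule sum.cong)
    fix F assume F: "F \<in> Pow U"
    have "insert a U - F = insert a (U - F)" using F assms by auto
    then have "card (insert a U - F) = Suc (card (U - F))" using assms by auto
    then show "?w (insert a U) F = (1 - p) * (?w U F)" by simp
  qed simp
  also have "sum (?w (insert a U)) (insert a ` Pow U) = p * bernoulli_weight p U (\<lambda>F. Ev (insert a F))"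
    unfolding bernoulli_weight_def sum_distrib_left sum.reindex[OF inj]
  proof (rule sum.cong)
    fix F assume F: "F \<in> Pow U"
    have "insert a U - insert a F = U - F" using F assms by auto
    moreover have "card (insert a F) = Suc (card F)" using F assms by (metis PowD card_insert_disjoint finite_subset subsetD)
    ultimately show "(?w (insert a U) \<circ> insert a) F = p * (if Ev (insert a F) then p ^ card F * (1 - p) ^ card (U - F) else 0)"
      by simp
  qed simp
  finally show ?thesis by simp
qed

lemma bernoulli_weight_mono:
  assumes "0 \<le> p" "p \<le> 1" "\<And>F. F \<subseteq> U \<Longrightarrow> Ev F \<Longrightarrow> Ev' F"
  shows "bernoulli_weight p U Ev \<le> bernoulli_weight p U Ev'"
  unfolding bernoulli_weight_def by (rule sum_mono) (use assms in auto)

lemma bernoulli_weight_avoid: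
  assumes "finite U" "Q \<subseteq> U"
  shows "bernoulli_weight p U (\<lambda>F. F \<inter> Q = {}) = (1 - p) ^ card Q"
  using assms
proof (induction U arbitrary: Q rule: finite_induct)
  case empty
  then show ?case by (simp add: bernoulli_weight_def)
next
  case (insert a U)
  have rec: "bernoulli_weight p (insert a U) (\<lambda>F. F \<inter> Q = {}) =
      p * bernoulli_weight p U (\<lambda>F. insert a F \<inter> Q = {}) + (1 - p) * bernoulli_weight p U (\<lambda>F. F \<inter> Q = {})"
    by (rule bernoulli_weight_insert) (use insert.hyps in auto)
  show ?case
  proof (cases "a \<in> Q")
    case True
    have hit: "bernoulli_weight p U (\<lambda>F. insert a F \<inter> Q = {}) = 0"
      using True by (simp add: bernoulli_weight_def)
    have "bernoulli_weight p U (\<lambda>F. F \<inter> Q = {}) = bernoulli_weight p U (\<lambda>F. F \<inter> (Q - {a}) = {})"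
      unfolding bernoulli_weight_def
    proof (rule sum.cong)
      fix F assume "F \<in> Pow U"
      then have "F \<inter> Q = F \<inter> (Q - {a})" using insert.hyps by auto
      then show "(if F \<inter> Q = {} then p ^ card F * (1 - p) ^ card (U - F) else 0) =
          (if F \<inter> (Q - {a}) = {} then p ^ card F * (1 - p) ^ card (U - F) else 0)" by simp
    qed simp
    also have "\<dots> = (1 - p) ^ card (Q - {a})" by (rule insert.IH) (use insert.prems in auto)
    finally have "bernoulli_weight p U (\<lambda>F. F \<inter> Q = {}) = (1 - p) ^ card (Q - {a})" .
    moreover have "card Q = Suc (card (Q - {a}))"
      using True insert.prems insert.hyps(1) by (metis card_Suc_Diff1 finite_insert finite_subset)
    ultimately show ?thesis unfolding rec hit by simp
  next
    case False
    then have "bernoulli_weight p U (\<lambda>F. F \<inter> Q = {}) = (1 - p) ^ card Q"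
      by (intro insert.IH) (use insert.prems in auto)
    moreover have "(insert a F \<inter> Q = {}) = (F \<inter> Q = {})" for F using False by auto
    ultimately show ?thesis unfolding rec by (simp add: algebra_simps)
  qed
qed

lemma bernoulli_weight_le_1:
  assumes "finite U" "0 \<le> p" "p \<le> 1"
  shows "bernoulli_weight p U Ev \<le> 1"
proof -
  have "bernoulli_weight p U Ev \<le> bernoulli_weight p U (\<lambda>F. F \<inter> {} = {})"
    using assms by (intro bernoulli_weight_mono) auto
  also have "\<dots> = 1" using bernoulli_weight_avoid[OF assms(1), of "{}" p] by simp
  finally show ?thesis .
qed

text \<open>
  If \<open>3/2\<close>-growth fails for \<open>a\<close>, then at least half of the \<open>s \<in> S\<close> have \<open>a + s \<in> S\<close>. By cancellation a
  pair \<open>(s, a + s)\<close> determines \<open>a\<close>, so the pairs arising from different \<open>a\<close> are different elements of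
  \<open>S \<times> S\<close>, and at most \<open>2 |S|\<close> elements \<open>a\<close> can be bad.
\<close>

lemma exists_expanding_translate:
  fixes S D :: "'a::cancel_comm_monoid_add set"
  assumes "finite S" "finite D" and card: "2 * card S < card D"
  shows "\<exists>a\<in>D. 3 * card S \<le> 2 * card (S \<union> (+) a ` S)"
proof (rule ccontr)
  assume "\<not> ?thesis"
  then have bad: "2 * card (S \<union> (+) a ` S) < 3 * card S" if "a \<in> D" for a
    using that by force
  define R where "R a = {s\<in>S. a + s \<in> S}" for a
  have R: "card S \<le> 2 * card (R a)" if "a \<in> D" for a
  proof -
    have inj: "inj_on ((+) a) X" for X by (auto simp: inj_on_def)
    have "S \<inter> (+) a ` S = (+) a ` R a" by (auto simp: R_def)
    then have "card (S \<inter> (+) a ` S) = card (R a)" using card_image[OF inj] by metis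
    moreover have "card S + card ((+) a ` S) = card (S \<union> (+) a ` S) + card (S \<inter> (+) a ` S)"
      by (rule card_Un_Int) (use assms in auto)
    ultimately show ?thesis using bad[OF that] card_image[OF inj, of S] by linarith
  qed
  have inj: "inj_on (\<lambda>(a, s). (s, a + s)) (Sigma D R)" by (auto simp: inj_on_def)
  have "(\<Sum>a\<in>D. card (R a)) = card (Sigma D R)"
    using assms by (subst card_SigmaI) (auto simp: R_def)
  also have "\<dots> = card ((\<lambda>(a, s). (s, a + s)) ` Sigma D R)" by (rule card_image[OF inj, symmetric])
  also have "\<dots> \<le> card (S \<times> S)"
    by (rule card_mono) (use assms in \<open>auto simp: R_def\<close>)
  finally have 1: "(\<Sum>a\<in>D. card (R a)) \<le> card S * card S" by (simp add: card_cartesian_product)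
  have "card D * card S = (\<Sum>a\<in>D. card S)" by simp
  also have "\<dots> \<le> (\<Sum>a\<in>D. 2 * card (R a))" using R by (intro sum_mono)
  also have "\<dots> \<le> 2 * card S * card S" using 1 by (simp add: sum_distrib_left[symmetric])
  finally have "card S = 0" using card by (simp add: mult_le_cancel2)
  then have "S = {}" using assms by simp
  moreover obtain a where "a \<in> D" using card by (cases "D = {}") auto
  ultimately show False using bad by auto
qed

text \<open>
  Here \<open>S\<close> is the set of sums built so far, \<open>D\<close> holds the elements that are not yet exposed and may still be
  used to enlarge \<open>S\<close>, and \<open>E\<close> supplies the last summand. The number \<open>r\<close> bounds the enlargements still to be
  made; \<open>r\<close> growth steps by the factor \<open>3/2\<close> are enough to reach the target size \<open>T\<close>. The last hypothesis
  says that no choice of at most \<open>r\<close> further summands from \<open>D\<close> moves the required last summand out of \<open>E\<close>.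

  The first exponential bounds the probability of running out of \<open>D\<close> before \<open>T\<close> is reached, by a Chernoff
  argument: exposing one element averages the factors \<open>1 / e\<close> of a success, which lowers \<open>r\<close> by one, and \<open>1\<close> of a
  failure, and \<open>p / e + (1 - p) \<le> exp (- p / 2)\<close>. An expanding element to expose exists as long as more than \<open>2 T\<close>
  elements are left, and when fewer are left the bound is trivial.
  The second exponential bounds the probability that all last summands belonging to a set \<open>S\<close> of size
  \<open>T\<close> are missing. The element to expose depends on \<open>S\<close>, and so on the outcomes so far, but the elements
  remaining in \<open>D\<close> and \<open>E\<close> are still independent of those; this is why the induction can condition on one element.
\<close>

lemma adaptive_exposure:
  fixes x :: "'a::cancel_comm_monoid_add" and p T :: real
  assumes p: "0 \<le> p" "p \<le> 1" and "finite D" "finite E" "D \<inter> E = {}" "finite S"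
    and "T \<le> real (card S) * (3/2) ^ r"
    and "\<And>s G. s \<in> S \<Longrightarrow> G \<subseteq> D \<Longrightarrow> card G \<le> r \<Longrightarrow> \<exists>e\<in>E. x = s + \<Sum>G + e"
  shows "bernoulli_weight p (D \<union> E) (\<lambda>F. \<not> (\<exists>s\<in>S. \<exists>G. G \<subseteq> F \<inter> D \<and> (\<exists>e\<in>F \<inter> E. x = s + \<Sum>G + e)))
    \<le> exp (real r - p * (card D - 2 * T) / 2) + exp (- p * T)"
  using assms(3-)
proof (induction "card D" arbitrary: D S r rule: less_induct)
  case less
  note fin = less.prems(1,2,4) and disj = less.prems(3) and big = less.prems(5) and reach = less.prems(6)
  define miss where "miss D S F \<longleftrightarrow> \<not> (\<exists>s\<in>S. \<exists>G. G \<subseteq> F \<inter> D \<and> (\<exists>e\<in>F \<inter> E. x = s + \<Sum>G + e))" for D S F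
  have goal: ?case if "bernoulli_weight p (D \<union> E) (miss D S) \<le> exp (real r - p * (card D - 2 * T) / 2) + exp (- p * T)"
    using that unfolding miss_def .
  show ?case
  proof (rule goal, cases "T \<le> card S")
    case True
    (* S is large enough: distinct s need distinct last summands, and all of them have to be missing. *)
    have "\<exists>e\<in>E. x = s + e" if "s \<in> S" for s using reach[OF that, of "{}"] by auto
    then obtain e where e: "\<And>s. s \<in> S \<Longrightarrow> e s \<in> E \<and> x = s + e s" by metis
    have "inj_on e S" by (rule inj_onI) (metis e add_right_cancel)
    then have card: "card (e ` S) = card S" by (rule card_image)
    have "bernoulli_weight p (D \<union> E) (miss D S) \<le> bernoulli_weight p (D \<union> E) (\<lambda>F. F \<inter> e ` S = {})"
    proof (rule bernoulli_weight_mono[OF p])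
      fix F assume F: "F \<subseteq> D \<union> E" "miss D S F"
      have "e s \<notin> F" if "s \<in> S" for s
      proof
        assume "e s \<in> F"
        then have "\<exists>s\<in>S. \<exists>G. G \<subseteq> F \<inter> D \<and> (\<exists>e\<in>F \<inter> E. x = s + \<Sum>G + e)"
          using e[OF that] that by (intro bexI[of _ s] exI[of _ "{}"] conjI bexI[of _ "e s"]) auto
        then show False using F by (simp add: miss_def)
      qed
      then show "F \<inter> e ` S = {}" by auto
    qed
    also have "\<dots> = (1 - p) ^ card S"
      using fin e card by (subst bernoulli_weight_avoid) auto
    also have "\<dots> \<le> exp (- p) ^ card S"
      using p exp_ge_add_one_self[of "-p"] by (intro power_mono) auto
    also have "\<dots> = exp (- p * card S)" by (simp add: exp_of_nat_mult[symmetric] mult.commute)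
    also have "\<dots> \<le> exp (- p * T)" using True p by (simp add: mult_left_mono)
    finally show "bernoulli_weight p (D \<union> E) (miss D S) \<le> exp (real r - p * (card D - 2 * T) / 2) + exp (- p * T)"
      by (smt (verit) exp_gt_zero)
  next
    case small: False
    have r: "r \<noteq> 0" using small big by (intro notI) auto
    show "bernoulli_weight p (D \<union> E) (miss D S) \<le> exp (real r - p * (card D - 2 * T) / 2) + exp (- p * T)"
    proof (cases "card D \<le> 2 * T")
      case True
      then have "p * (card D - 2 * T) \<le> 0" using p by (simp add: mult_nonneg_nonpos)
      then have "1 \<le> exp (real r - p * (card D - 2 * T) / 2)" by simp
      moreover have "bernoulli_weight p (D \<union> E) (miss D S) \<le> 1"
        using fin p by (intro bernoulli_weight_le_1) auto
      ultimately show ?thesis by (smt (verit) exp_gt_zero)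
    next
      case False
      then have "2 * card S < card D" using small by linarith
      then obtain a where a: "a \<in> D" and grow: "3 * card S \<le> 2 * card (S \<union> (+) a ` S)"
        using exists_expanding_translate fin by blast
      define D' where "D' = D - {a}"
      define S' where "S' = S \<union> (+) a ` S"
      have D': "card D = Suc (card D')" "card D' < card D" "finite D'" "D' \<inter> E = {}" "a \<notin> D' \<union> E"
        using a fin disj card_Suc_Diff1[OF fin(1) a] by (auto simp: D'_def simp del: card_Diff_singleton)
      have D'E: "D \<union> E = insert a (D' \<union> E)" using a by (auto simp: D'_def)
      have S': "finite S'" using fin by (auto simp: S'_def)
      have big': "T \<le> real (card S') * (3/2) ^ (r - 1)"
      proof -
        have "T \<le> real (card S) * (3/2) ^ r" by (rule big)
        also have "\<dots> = (3/2 * real (card S)) * (3/2) ^ (r - 1)" using r by (cases r) auto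
        also have "\<dots> \<le> real (card S') * (3/2) ^ (r - 1)"
          using grow by (intro mult_right_mono) (auto simp: S'_def)
        finally show ?thesis .
      qed
      (* If a is in the random set, then reaching x from S' without a means reaching it from S with the help of a. *)
      have "bernoulli_weight p (D' \<union> E) (\<lambda>F. miss D S (insert a F)) \<le> bernoulli_weight p (D' \<union> E) (miss D' S')"
      proof (rule bernoulli_weight_mono[OF p], rule ccontr)
        fix F assume F: "F \<subseteq> D' \<union> E" and m: "miss D S (insert a F)" and "\<not> miss D' S' F"
        then obtain s G e where s: "s \<in> S'" "G \<subseteq> F \<inter> D'" "e \<in> F \<inter> E" "x = s + \<Sum>G + e"
          by (auto simp: miss_def)
        have finG: "finite G" using s D' by (meson finite_subset le_infE)
        show False
        proof (cases "s \<in> S")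
          case True
          then have "\<exists>s\<in>S. \<exists>G. G \<subseteq> insert a F \<inter> D \<and> (\<exists>e\<in>insert a F \<inter> E. x = s + \<Sum>G + e)"
            using s by (intro bexI[of _ s] exI[of _ G] conjI bexI[of _ e]) (auto simp: D'_def)
          then show False using m by (simp add: miss_def)
        next
          case False
          then obtain s0 where s0: "s0 \<in> S" "s = a + s0" using s by (auto simp: S'_def)
          have "a \<notin> G" using s by (auto simp: D'_def)
          then have "x = s0 + \<Sum>(insert a G) + e" using s s0 finG by (simp add: algebra_simps)
          then have "\<exists>s\<in>S. \<exists>G. G \<subseteq> insert a F \<inter> D \<and> (\<exists>e\<in>insert a F \<inter> E. x = s + \<Sum>G + e)"
            using s s0 a by (intro bexI[of _ s0] exI[of _ "insert a G"] conjI bexI[of _ e]) (auto simp: D'_def)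
          then show False using m by (simp add: miss_def)
        qed
      qed
      also have "\<dots> \<le> exp (real (r - 1) - p * (card D' - 2 * T) / 2) + exp (- p * T)"
        unfolding miss_def
      proof (rule less.hyps[OF D'(2,3) fin(2) D'(4) S' big'])
        fix s G assume s: "s \<in> S'" "G \<subseteq> D'" "card G \<le> r - 1"
        have finG: "finite G" using s D' by (meson finite_subset)
        show "\<exists>e\<in>E. x = s + \<Sum>G + e"
        proof (cases "s \<in> S")
          case True
          then show ?thesis using s by (intro reach) (auto simp: D'_def)
        next
          case False
          then obtain s0 where s0: "s0 \<in> S" "s = a + s0" using s by (auto simp: S'_def)
          have aG: "a \<notin> G" using s by (auto simp: D'_def)
          have "\<exists>e\<in>E. x = s0 + \<Sum>(insert a G) + e"
            using s s0 a r aG finG by (intro reach) (auto simp: D'_def)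
          then show ?thesis using s0 aG finG by (simp add: algebra_simps)
        qed
      qed
      finally have hit: "bernoulli_weight p (D' \<union> E) (\<lambda>F. miss D S (insert a F))
          \<le> exp (real (r - 1) - p * (card D' - 2 * T) / 2) + exp (- p * T)" .
      have "bernoulli_weight p (D' \<union> E) (miss D S) \<le> bernoulli_weight p (D' \<union> E) (miss D' S)"
        by (rule bernoulli_weight_mono[OF p]) (auto simp: miss_def D'_def)
      also have "\<dots> \<le> exp (real r - p * (card D' - 2 * T) / 2) + exp (- p * T)"
        unfolding miss_def
        by (rule less.hyps[OF D'(2,3) fin(2) D'(4) fin(3) big], rule reach) (auto simp: D'_def)
      finally have nohit: "bernoulli_weight p (D' \<union> E) (miss D S)
          \<le> exp (real r - p * (card D' - 2 * T) / 2) + exp (- p * T)" .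
      define Y where "Y = exp (real r - p * (card D' - 2 * T) / 2)"
      have Y: "exp (real (r - 1) - p * (card D' - 2 * T) / 2) = exp (-1) * Y"
        using r by (simp add: Y_def mult_exp_exp of_nat_diff)
      have Y2: "exp (real r - p * (card D - 2 * T) / 2) = exp (- p / 2) * Y"
        by (simp add: Y_def mult_exp_exp D' algebra_simps add_divide_distrib diff_divide_distrib)
      have "exp (-1::real) \<le> 1/2" using exp_ge_add_one_self[of "1::real"] by (simp add: exp_minus field_simps)
      then have "p * exp (-1) + (1 - p) \<le> 1 - p / 2"
        using p mult_left_mono[of "exp (-1)" "1/2" p] by simp
      also have "\<dots> \<le> exp (- p / 2)" using exp_ge_add_one_self[of "-p/2"] by simp
      finally have q: "p * exp (-1) + (1 - p) \<le> exp (- p / 2)" .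
      have "bernoulli_weight p (D \<union> E) (miss D S) = p * bernoulli_weight p (D' \<union> E) (\<lambda>F. miss D S (insert a F))
          + (1 - p) * bernoulli_weight p (D' \<union> E) (miss D S)"
        unfolding D'E by (rule bernoulli_weight_insert) (use D' fin in auto)
      also have "\<dots> \<le> p * (exp (-1) * Y + exp (- p * T)) + (1 - p) * (Y + exp (- p * T))"
        using hit nohit p unfolding Y Y_def[symmetric] by (intro add_mono mult_left_mono) auto
      also have "\<dots> = (p * exp (-1) + (1 - p)) * Y + exp (- p * T)" by (simp add: algebra_simps)
      also have "\<dots> \<le> exp (- p / 2) * Y + exp (- p * T)"
        using q by (intro add_right_mono mult_right_mono) (auto simp: Y_def)
      finally show ?thesis unfolding Y2 .
    qed
  qed
qed

section \<open>Finite marginals of the coin flips and measurability\<close>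

lemma space_coin_flips [simp]: "space (coin_flips p) = UNIV"
  by (simp add: coin_flips_def space_PiM)

lemma prob_space_coin_flips: "prob_space (coin_flips p)"
  unfolding coin_flips_def by (intro prob_space_PiM prob_space_measure_pmf)

lemma coin_flips_pattern:
  fixes U :: "'a set"
  assumes "finite U" "F \<subseteq> U" "0 \<le> p" "p \<le> 1"
  shows "{\<omega>. {x. \<omega> x} \<inter> U = F} \<in> sets (coin_flips p)"
    and "measure (coin_flips p) {\<omega>. {x. \<omega> x} \<inter> U = F} = p ^ card F * (1 - p) ^ card (U - F)"
proof -
  interpret product_prob_space "\<lambda>x::'a. measure_pmf (bernoulli_pmf p)" UNIV
    by standard
  let ?M = "\<lambda>x::'a. measure_pmf (bernoulli_pmf p)"
  have eq: "{\<omega>. {x. \<omega> x} \<inter> U = F} = prod_emb UNIV ?M U (PiE U (\<lambda>x. {x \<in> F}))"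
    using assms(2) by (auto simp: prod_emb_def space_PiM PiE_iff)
  show "{\<omega>. {x. \<omega> x} \<inter> U = F} \<in> sets (coin_flips p)"
    unfolding eq coin_flips_def by (rule sets_PiM_I) (use assms in auto)
  have "measure (coin_flips p) {\<omega>. {x. \<omega> x} \<inter> U = F} = (\<Prod>x\<in>U. measure (?M x) {x \<in> F})"
    unfolding eq coin_flips_def by (rule measure_PiM_emb) (use assms in auto)
  also have "\<dots> = (\<Prod>x\<in>U. if x \<in> F then p else 1 - p)"
    using assms by (intro prod.cong) (auto simp: measure_pmf_single)
  also have "\<dots> = p ^ card (U \<inter> {x. x \<in> F}) * (1 - p) ^ card (U \<inter> - {x. x \<in> F})"
    using assms(1) by (subst prod.If_cases) auto
  also have "\<dots> = p ^ card F * (1 - p) ^ card (U - F)"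
    using assms(2) by (intro arg_cong2[where f = "(*)"] arg_cong2[where f = "(^)"] arg_cong[where f = card]) auto
  finally show "measure (coin_flips p) {\<omega>. {x. \<omega> x} \<inter> U = F} = p ^ card F * (1 - p) ^ card (U - F)" .
qed

text \<open>
  Events that only look at finitely many elements are finite disjoint unions of patterns, so they are
  measurable and their probability is the finite sum above.
\<close>

lemma coin_flips_local_event:
  fixes U :: "'a set"
  assumes "finite U" "0 \<le> p" "p \<le> 1"
  shows "{\<omega>. Ev ({x. \<omega> x} \<inter> U)} \<in> sets (coin_flips p)"
    and "measure (coin_flips p) {\<omega>. Ev ({x. \<omega> x} \<inter> U)} = bernoulli_weight p U Ev"
proof -
  interpret prob_space "coin_flips p :: ('a \<Rightarrow> bool) measure" by (rule prob_space_coin_flips)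
  have eq: "{\<omega>. Ev ({x. \<omega> x} \<inter> U)} = (\<Union>F\<in>{F\<in>Pow U. Ev F}. {\<omega>. {x. \<omega> x} \<inter> U = F})" by auto
  have fin: "finite {F\<in>Pow U. Ev F}" using assms by simp
  have meas: "{\<omega>. {x. \<omega> x} \<inter> U = F} \<in> sets (coin_flips p)" if "F \<in> {F\<in>Pow U. Ev F}" for F
    using that assms by (intro coin_flips_pattern) auto
  show "{\<omega>. Ev ({x. \<omega> x} \<inter> U)} \<in> sets (coin_flips p)"
    unfolding eq using fin meas by blast
  have "measure (coin_flips p) {\<omega>. Ev ({x. \<omega> x} \<inter> U)} =
      (\<Sum>F\<in>{F\<in>Pow U. Ev F}. measure (coin_flips p) {\<omega>. {x. \<omega> x} \<inter> U = F})"
    unfolding eq by (rule finite_measure_finite_Union[OF fin]) (use meas in \<open>auto simp: disjoint_family_on_def\<close>)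
  also have "\<dots> = (\<Sum>F\<in>{F\<in>Pow U. Ev F}. p ^ card F * (1 - p) ^ card (U - F))"
    using assms by (intro sum.cong coin_flips_pattern) auto
  also have "\<dots> = bernoulli_weight p U Ev"
    unfolding bernoulli_weight_def by (rule sum.inter_filter) (use assms in simp)
  finally show "measure (coin_flips p) {\<omega>. Ev ({x. \<omega> x} \<inter> U)} = bernoulli_weight p U Ev" .
qed

lemma coin_flips_contains:
  fixes F :: "'a set"
  assumes "finite F" "0 \<le> p" "p \<le> 1"
  shows "{\<omega>. F \<subseteq> {x. \<omega> x}} \<in> sets (coin_flips p)"
    and "measure (coin_flips p) {\<omega>. F \<subseteq> {x. \<omega> x}} = p ^ card F"
proof -
  have "{\<omega>. F \<subseteq> {x. \<omega> x}} = {\<omega>. {x. \<omega> x} \<inter> F = F}" by auto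
  then show "{\<omega>. F \<subseteq> {x. \<omega> x}} \<in> sets (coin_flips p)"
    and "measure (coin_flips p) {\<omega>. F \<subseteq> {x. \<omega> x}} = p ^ card F"
    using coin_flips_pattern[OF assms(1) order.refl assms(2,3)] by auto
qed

lemma subset_sums_mono: "A \<subseteq> B \<Longrightarrow> subset_sums A \<subseteq> subset_sums B"
  by (auto simp: subset_sums_def)

lemma sets_subset_sum:
  assumes "0 \<le> p" "p \<le> 1"
  shows "{\<omega>. x \<in> subset_sums {a::'a::{countable,comm_monoid_add}. \<omega> a}} \<in> sets (coin_flips p)"
proof -
  have "{\<omega>. x \<in> subset_sums {a::'a. \<omega> a}} = (\<Union>F\<in>{F. finite F \<and> x = \<Sum>F}. {\<omega>. F \<subseteq> {a. \<omega> a}})"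
    by (auto simp: subset_sums_def)
  moreover have "countable {F :: 'a set. finite F \<and> x = \<Sum>F}"
    by (rule countable_subset[OF _ countable_Collect_finite]) auto
  ultimately show ?thesis
    using coin_flips_contains(1)[OF _ assms] by (auto intro!: sets.countable_UN'')
qed

text \<open>
  There are only countably many finite sets that can be the gap set, and prescribing the gap set is a
  countable conjunction of membership events; so any property whatsoever of a cofinite set of subset sums is
  measurable.
\<close>

lemma sets_gap_event:
  fixes Q :: "'a::{countable,comm_monoid_add} set \<Rightarrow> bool"
  assumes "0 \<le> p" "p \<le> 1"
  shows "{\<omega>. finite (UNIV - subset_sums {a. \<omega> a}) \<and> Q (subset_sums {a. \<omega> a})} \<in> sets (coin_flips p)"
proof -
  let ?S = "\<lambda>\<omega>. subset_sums {a::'a. \<omega> a}"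
  have "{\<omega>. ?S \<omega> = - T} \<in> sets (coin_flips p)" for T
  proof -
    have "{\<omega>. ?S \<omega> = - T} = (\<Inter>x. {\<omega>. x \<in> ?S \<omega> \<longleftrightarrow> x \<notin> T})"
      by (rule set_eqI) (simp add: set_eq_iff)
    moreover have "{\<omega>. x \<in> ?S \<omega> \<longleftrightarrow> x \<notin> T} \<in> sets (coin_flips p)" for x
    proof (cases "x \<in> T")
      case True
      then have "{\<omega>. x \<in> ?S \<omega> \<longleftrightarrow> x \<notin> T} = space (coin_flips p) - {\<omega>. x \<in> ?S \<omega>}" by auto
      then show ?thesis using sets_subset_sum[OF assms, of x] by (simp only: sets.compl_sets)
    next
      case False
      then show ?thesis using sets_subset_sum[OF assms, of x] by simp
    qed
    ultimately show ?thesis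
      using sets.top[of "coin_flips p :: ('a \<Rightarrow> bool) measure"]
      by (simp only: space_coin_flips) (rule sets.countable_INT'', auto)
  qed
  moreover have "{\<omega>. finite (UNIV - ?S \<omega>) \<and> Q (?S \<omega>)} = (\<Union>T\<in>{T. finite T \<and> Q (- T)}. {\<omega>. ?S \<omega> = - T})"
  proof (rule set_eqI)
    fix \<omega>
    have "?S \<omega> = - T \<longleftrightarrow> T = UNIV - ?S \<omega>" for T by blast
    then show "\<omega> \<in> {\<omega>. finite (UNIV - ?S \<omega>) \<and> Q (?S \<omega>)} \<longleftrightarrow>
        \<omega> \<in> (\<Union>T\<in>{T. finite T \<and> Q (- T)}. {\<omega>. ?S \<omega> = - T})"
      by (simp add: Compl_eq_Diff_UNIV double_diff)
  qed
  moreover have "countable {T :: 'a set. finite T \<and> Q (- T)}"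
    by (rule countable_subset[OF _ countable_Collect_finite]) auto
  ultimately show ?thesis by (auto intro!: sets.countable_UN'')
qed

section \<open>Boxes and the shifted product\<close>

text \<open>
  This evaluates cardinalities of boxes (with all factors equal to one) as well as power sums and exponential
  sums over them.
\<close>

lemma sum_prod_vec_box:
  fixes f :: "'d::finite \<Rightarrow> 'b \<Rightarrow> 'c::comm_semiring_1"
  assumes "\<And>i. finite (A i)"
  shows "finite {x :: 'b ^ 'd. \<forall>i. x $ i \<in> A i}"
    and "(\<Sum>x | \<forall>i. x $ i \<in> A i. \<Prod>i\<in>UNIV. f i (x $ i)) = (\<Prod>i\<in>UNIV. \<Sum>b\<in>A i. f i b)"
proof -
  have eq: "{x :: 'b ^ 'd. \<forall>i. x $ i \<in> A i} = vec_lambda ` PiE UNIV A"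
    by (auto simp: PiE_def image_iff intro!: bexI[of _ "vec_nth _"])
  have inj: "inj_on vec_lambda (PiE UNIV A)"
    by (auto simp: inj_on_def vec_lambda_inject)
  show "finite {x :: 'b ^ 'd. \<forall>i. x $ i \<in> A i}"
    unfolding eq using assms by (intro finite_imageI finite_PiE) auto
  show "(\<Sum>x | \<forall>i. x $ i \<in> A i. \<Prod>i\<in>UNIV. f i (x $ i)) = (\<Prod>i\<in>UNIV. \<Sum>b\<in>A i. f i b)"
    unfolding eq sum.reindex[OF inj] using assms by (subst prod_sum_PiE) auto
qed

lemma
  fixes c :: "'d::finite \<Rightarrow> nat"
  shows finite_box: "finite {a :: nat ^ 'd. \<forall>i. a $ i \<le> c i}"
    and card_box: "card {a :: nat ^ 'd. \<forall>i. a $ i \<le> c i} = (\<Prod>i\<in>UNIV. c i + 1)"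
  using sum_prod_vec_box(1)[of "\<lambda>i. {..c i}"]
    sum_prod_vec_box(2)[of "\<lambda>i. {..c i}" "\<lambda>i n. 1::nat"] by simp_all

definition shifted_product :: "real \<Rightarrow> nat ^ 'd \<Rightarrow> real" where
  "shifted_product L x = (\<Prod>i\<in>UNIV. real (x $ i) + L)"

lemma region_alt: "region p Z = {x. shifted_product (ln (1 / p)) x \<le> Z}"
  by (simp add: region_def shifted_product_def)

lemma coordinate_le_shifted_product:
  assumes "1 \<le> L"
  shows "real (x $ i) + L \<le> shifted_product L x"
proof -
  have "(\<Prod>j\<in>UNIV - {i}. 1) \<le> (\<Prod>j\<in>UNIV - {i}. real (x $ j) + L)"
    using assms by (intro prod_mono) auto
  then have "(real (x $ i) + L) * 1 \<le> (real (x $ i) + L) * (\<Prod>j\<in>UNIV - {i}. real (x $ j) + L)"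
    using assms by (intro mult_left_mono) auto
  also have "\<dots> = shifted_product L x"
    unfolding shifted_product_def by (rule prod.remove[symmetric]) auto
  finally show ?thesis by simp
qed

lemma eventually_small_p:
  assumes "\<And>p. 0 < p \<Longrightarrow> p < 1 \<Longrightarrow> L0 \<le> ln (1 / p) \<Longrightarrow> P p"
  shows "eventually P (at_right (0::real))"
proof -
  have "filterlim (\<lambda>p::real. ln (1 / p)) at_top (at_right 0)" by real_asymp
  then have "eventually (\<lambda>p::real. L0 \<le> ln (1 / p)) (at_right 0)" by (simp add: filterlim_at_top)
  moreover have "eventually (\<lambda>p::real. 0 < p \<and> p < 1) (at_right 0)"
    by (auto simp: eventually_at_right_field intro: exI[of _ 1])
  ultimately show ?thesis by eventually_elim (use assms in auto)
qed

section \<open>Covering of the points outside the region\<close>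

text \<open>
  The exposure argument for a vector \<open>x\<close>: the growing sums use at most \<open>k\<close> vectors bounded by \<open>x / (2 k)\<close>, so
  they stay below \<open>x / 2\<close>. The last summand is then at least \<open>x / 2\<close>, which for \<open>k \<ge> 2\<close> exceeds \<open>x / (2 k)\<close> in
  every non-zero coordinate of \<open>x\<close>; hence it is never among the vectors exposed before.
\<close>

lemma uncovered_probability_le:
  fixes x :: "nat ^ 'd"
  assumes p: "0 \<le> p" "p \<le> 1" and k: "2 \<le> k" and "x \<noteq> 0" and T: "T \<le> (3/2) ^ k"
  defines "n \<equiv> \<Prod>i\<in>UNIV. x $ i div (2 * k) + 1"
  defines "B \<equiv> {a. \<forall>i. a $ i \<le> x $ i}"
  shows "bernoulli_weight p B (\<lambda>F. x \<notin> subset_sums F)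
     \<le> exp (real k - p * (n - 2 * T) / 2) + exp (- p * T)"
proof -
  define D where "D = {a :: nat ^ 'd. \<forall>i. a $ i \<le> x $ i div (2 * k)}"
  define E where "E = B - D"
  have DB: "D \<subseteq> B" unfolding D_def B_def using div_le_dividend le_trans by blast
  have fin: "finite D" "finite E" unfolding E_def D_def B_def by (auto intro: finite_box)
  have DE: "D \<union> E = B" "D \<inter> E = {}" using DB by (auto simp: E_def)
  have cardD: "card D = n" unfolding D_def n_def by (rule card_box)
  have "bernoulli_weight p (D \<union> E) (\<lambda>F. x \<notin> subset_sums F) \<le>
     bernoulli_weight p (D \<union> E) (\<lambda>F. \<not> (\<exists>s\<in>{0}. \<exists>G. G \<subseteq> F \<inter> D \<and> (\<exists>e\<in>F \<inter> E. x = s + \<Sum>G + e)))"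
  proof (rule bernoulli_weight_mono[OF p], rule ccontr)
    fix F assume F: "F \<subseteq> D \<union> E" "x \<notin> subset_sums F"
      "\<not> \<not> (\<exists>s\<in>{0}. \<exists>G. G \<subseteq> F \<inter> D \<and> (\<exists>e\<in>F \<inter> E. x = s + \<Sum>G + e))"
    then obtain G e where G: "G \<subseteq> F \<inter> D" "e \<in> F \<inter> E" "x = \<Sum>G + e" by auto
    have "finite G" "e \<notin> G" using G fin DE by (auto intro: finite_subset)
    then have "x = \<Sum>(insert e G)" using G by (simp add: add.commute)
    then have "x \<in> subset_sums F" using G \<open>finite G\<close> by (auto simp: subset_sums_def intro!: exI[of _ "insert e G"])
    then show False using F by simp
  qed
  also have "\<dots> \<le> exp (real k - p * (card D - 2 * T) / 2) + exp (- p * T)"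
  proof (rule adaptive_exposure[OF p fin DE(2)])
    fix s and G :: "(nat ^ 'd) set" assume G: "s \<in> {0 :: nat ^ 'd}" "G \<subseteq> D" "card G \<le> k"
    have half: "2 * (\<Sum>G $ i) \<le> x $ i" for i
    proof -
      have "\<Sum>G $ i = (\<Sum>a\<in>G. a $ i)" by simp
      also have "\<dots> \<le> (\<Sum>a\<in>G. x $ i div (2 * k))" using G by (intro sum_mono) (auto simp: D_def)
      also have "\<dots> \<le> k * (x $ i div (2 * k))" using G by simp
      finally have "2 * (\<Sum>G $ i) \<le> 2 * k * (x $ i div (2 * k))" by simp
      also have "\<dots> \<le> x $ i" by simp
      finally show ?thesis .
    qed
    define e where "e = (\<chi> i. x $ i - \<Sum>G $ i)"
    have xe: "x = s + \<Sum>G + e"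
      unfolding vec_eq_iff
    proof
      fix i
      have "\<Sum>G $ i \<le> x $ i" using half[of i] by linarith
      then show "x $ i = (s + \<Sum>G + e) $ i" using G(1) by (simp add: e_def)
    qed
    have "e \<in> B" by (auto simp: e_def B_def)
    moreover have "e \<notin> D"
    proof
      assume "e \<in> D"
      obtain i where i: "x $ i \<noteq> 0" using \<open>x \<noteq> 0\<close> by (auto simp: vec_eq_iff)
      have "e $ i \<le> x $ i div (2 * k)" using \<open>e \<in> D\<close> by (simp add: D_def)
      moreover have "2 * (e $ i) \<ge> x $ i" using half[of i] by (simp add: e_def)
      moreover have "2 * k * (x $ i div (2 * k)) \<le> x $ i" by simp
      moreover have "2 * 2 * (x $ i div (2 * k)) \<le> 2 * k * (x $ i div (2 * k))"
        using k by (intro mult_right_mono) auto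
      ultimately show False using i by linarith
    qed
    ultimately show "\<exists>e\<in>E. x = s + \<Sum>G + e" using xe by (auto simp: E_def)
  qed (use T in auto)
  finally show ?thesis unfolding DE cardD .
qed

lemma power_le_exp:
  assumes "0 \<le> u" "0 < m"
  shows "u ^ m \<le> real m ^ m * exp u"
proof -
  have "u / m \<le> exp (u / m)" using exp_ge_add_one_self[of "u / m"] by linarith
  then have "(u / m) ^ m \<le> exp (u / m) ^ m" using assms by (intro power_mono) auto
  also have "\<dots> = exp u" using assms by (simp add: exp_of_nat_mult[symmetric])
  finally show ?thesis using assms by (simp add: power_divide field_simps)
qed

text \<open>
  Choice of parameters. With \<open>k\<^bsup>d+1\<^esup> \<approx> p y / M\<close>, where \<open>y\<close> is the shifted product of \<open>x\<close>, the box of vectors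
  bounded by \<open>x / (2 k)\<close> has at least \<open>y / (4 k)\<^bsup>d\<^esup> \<ge> 10 k / p\<close> points; the value of \<open>M\<close> is made for this.
  With the target size \<open>T = 2 k / p\<close> both failure probabilities are then at most \<open>exp (- 2 k)\<close>. The constant
  \<open>C\<close> is chosen such that \<open>k \<ge> 10 L\<close>, so that \<open>1 / p \<le> exp (k / 10)\<close>, which makes \<open>T\<close> reachable in \<open>k\<close> growth steps.

  Finally one factor \<open>exp (- k)\<close> is turned into a power of \<open>p\<close>, and the other one into a bound of order
  \<open>(p y)\<^bsup>-2\<^esup>\<close> by comparing the exponential with a power of \<open>k\<close>; the exponent \<open>-2\<close> makes the bound summable
  over \<open>x\<close>.
\<close>

lemma uncovered_decay:
  "\<exists>C\<ge>1. \<exists>K>0. \<exists>L0. \<forall>p. \<forall>x :: nat ^ 'd. 0 < p \<longrightarrow> p < 1 \<longrightarrow> L0 \<le> ln (1 / p) \<longrightarrow>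
     C * (1 / p) * ln (1 / p) ^ (CARD('d) + 1) < shifted_product (ln (1 / p)) x \<longrightarrow>
     bernoulli_weight p {a :: nat ^ 'd. \<forall>i. a $ i \<le> x $ i} (\<lambda>F. x \<notin> subset_sums F)
       \<le> K * p ^ 8 / shifted_product (ln (1 / p)) x ^ 2"
proof -
  let ?d = "CARD('d)"
  define M :: real where "M = 10 * 4 ^ ?d"
  define C where "C = M * 11 ^ (?d + 1)"
  define m where "m = 2 * (?d + 1)"
  define C1 where "C1 = real m ^ m * exp 1"
  have "(1::real) \<le> 4 ^ ?d" by (rule one_le_power) simp
  then have M: "M \<ge> 1" unfolding M_def by linarith
  have C: "C \<ge> 1"
  proof -
    have "1 * 1 \<le> M * 11 ^ (?d + 1)" using M one_le_power[of "11::real" "?d + 1"] by (intro mult_mono) auto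
    then show ?thesis by (simp add: C_def)
  qed
  have C1: "C1 > 0" by (simp add: C1_def m_def)
  have "exp (1 / 3 :: real) \<le> 3 / 2"
    using exp_ge_add_one_self[of "- 1 / 3 :: real"] by (simp add: exp_minus field_simps)
  then have "exp (1 / 3) ^ k \<le> (3 / 2 :: real) ^ k" for k by (intro power_mono) auto
  then have exp_third: "exp (real k / 3) \<le> (3/2) ^ k" for k by (simp add: exp_of_nat_mult[symmetric])
  have "eventually (\<lambda>k. 2 * real k * exp (k / 10) \<le> exp (k / 3)) sequentially"
    by real_asymp
  then obtain k0 where k0: "\<And>k. k \<ge> k0 \<Longrightarrow> 2 * real k * exp (k / 10) \<le> exp (k / 3)"
    by (auto simp: eventually_sequentially)
  define L0 where "L0 = max 1 (real k0)"
  have main: "bernoulli_weight p {a :: nat ^ 'd. \<forall>i. a $ i \<le> x $ i} (\<lambda>F. x \<notin> subset_sums F)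
       \<le> 2 * C1 * M\<^sup>2 * p ^ 8 / shifted_product (ln (1 / p)) x ^ 2"
    if p: "0 < p" "p < 1" and L0: "L0 \<le> ln (1 / p)"
      and x: "C * (1 / p) * ln (1 / p) ^ (?d + 1) < shifted_product (ln (1 / p)) x" for p and x :: "nat ^ 'd"
  proof -
    define L where "L = ln (1 / p)"
    define y where "y = shifted_product L x"
    define w where "w = p * y / M"
    define k where "k = nat \<lfloor>root (?d + 1) w\<rfloor>"
    have L: "L \<ge> 1" "L \<ge> k0" using L0 by (auto simp: L_def L0_def)
    have yL: "C * (1 / p) * L ^ (?d + 1) < y" using x by (simp add: L_def y_def)
    have pe: "p = exp (- L)" using p by (simp add: L_def ln_div)
    have w: "(11 * L) ^ (?d + 1) < w"
      using yL p M by (simp add: w_def C_def power_mult_distrib field_simps)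
    have L11: "11 * L \<le> root (?d + 1) w"
    proof -
      have "11 * L = root (?d + 1) ((11 * L) ^ (?d + 1))" using L by (subst real_root_power_cancel) auto
      also have "\<dots> \<le> root (?d + 1) w" using w by (intro real_root_le_mono) auto
      finally show ?thesis .
    qed
    have k: "real k \<le> root (?d + 1) w" "root (?d + 1) w < real k + 1"
      using L11 L unfolding k_def by linarith+
    have k10: "10 * L \<le> k" using k L11 L by linarith
    have "0 < w" using w L by (smt (verit) zero_le_power)
    have rootw: "root (?d + 1) w ^ (?d + 1) = w"
      using \<open>0 < w\<close> by (intro real_root_pow_pos2) auto
    have kw: "real k ^ (?d + 1) \<le> w"
      using power_mono[OF k(1), of "?d + 1"] unfolding rootw by simp
    have wk: "w \<le> (real k + 1) ^ (?d + 1)"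
      using power_mono[OF less_imp_le[OF k(2)], of "?d + 1"] \<open>0 < w\<close> unfolding rootw by simp
    (* For x = 0 the shifted product is L ^ d, which is below the threshold. *)
    have "x \<noteq> 0"
    proof
      assume "x = 0"
      then have "y = 1 * L ^ ?d" by (simp add: y_def shifted_product_def)
      also have "\<dots> \<le> (C * (1 / p)) * L ^ (?d + 1)"
      proof (rule mult_mono)
        have "1 * 1 \<le> C * (1 / p)" using C p by (intro mult_mono) auto
        then show "1 \<le> C * (1 / p)" by simp
        show "L ^ ?d \<le> L ^ (?d + 1)" using L by (intro power_increasing) auto
      qed (use C p L in auto)
      finally show False using yL by simp
    qed
    define n where "n = (\<Prod>i\<in>UNIV. x $ i div (2 * k) + 1)"
    have kpos: "0 < real k" using k10 L by linarith
    have "y / (4 * k) ^ ?d = (\<Prod>i\<in>(UNIV::'d set). (real (x $ i) + L) / (4 * k))"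
      by (simp add: y_def shifted_product_def prod_dividef)
    also have "\<dots> \<le> (\<Prod>i\<in>(UNIV::'d set). real (x $ i div (2 * k) + 1))"
    proof (rule prod_mono)
      fix i :: 'd
      have "x $ i \<le> 2 * k * (x $ i div (2 * k)) + 2 * k"
        using kpos by (metis add_left_mono div_mult_mod_eq less_imp_le mod_less_divisor mult.commute nat_0_less_mult_iff of_nat_0_less_iff pos2)
      then have "real (x $ i) \<le> 2 * real k * real (x $ i div (2 * k)) + 2 * real k"
        by (metis (mono_tags, lifting) of_nat_add of_nat_le_iff of_nat_mult of_nat_numeral)
      moreover have "L \<le> 2 * real k * real (x $ i div (2 * k)) + 2 * real k"
        using kpos k10 L by (smt (verit) mult_nonneg_nonneg of_nat_0_le_iff)
      ultimately have "real (x $ i) + L \<le> (1 + real (x $ i div (2 * k))) * (4 * real k)"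
        by (simp add: algebra_simps)
      then show "0 \<le> (real (x $ i) + L) / (4 * k) \<and> (real (x $ i) + L) / (4 * k) \<le> real (x $ i div (2 * k) + 1)"
        using kpos L by (auto simp: pos_divide_le_eq)
    qed
    also have "\<dots> = n" by (simp add: n_def)
    finally have n1: "y / (4 * k) ^ ?d \<le> n" .
    have "10 * real k = M * real k ^ (?d + 1) / (4 * k) ^ ?d"
      using kpos by (simp add: M_def power_mult_distrib)
    also have "\<dots> \<le> M * w / (4 * k) ^ ?d"
      using kw M by (intro divide_right_mono mult_left_mono) auto
    also have "\<dots> = p * (y / (4 * k) ^ ?d)" using M by (simp add: w_def)
    also have "\<dots> \<le> p * n" using n1 p by (intro mult_left_mono) auto
    finally have pn: "10 * real k \<le> p * n" .
    have T: "2 * real k / p \<le> (3/2) ^ k"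
    proof -
      have "k \<ge> k0" using L k10 by linarith
      have "2 * real k / p = 2 * real k * exp L" using p by (simp add: L_def)
      also have "\<dots> \<le> 2 * real k * exp (k / 10)" using k10 by (intro mult_left_mono) auto
      also have "\<dots> \<le> exp (k / 3)" using k0[OF \<open>k \<ge> k0\<close>] .
      also have "\<dots> \<le> (3/2) ^ k" by (rule exp_third)
      finally show ?thesis .
    qed
    have "bernoulli_weight p {a :: nat ^ 'd. \<forall>i. a $ i \<le> x $ i} (\<lambda>F. x \<notin> subset_sums F)
        \<le> exp (real k - p * (n - 2 * (2 * real k / p)) / 2) + exp (- p * (2 * real k / p))"
      unfolding n_def using p kpos T \<open>x \<noteq> 0\<close> k10 L by (intro uncovered_probability_le) auto
    also have "real k - p * (n - 2 * (2 * real k / p)) / 2 = 3 * real k - p * n / 2"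
      using p by (simp add: algebra_simps diff_divide_distrib)
    also have "exp (3 * real k - p * n / 2) \<le> exp (- 2 * real k)" using pn by simp
    also have "exp (- p * (2 * real k / p)) = exp (- 2 * real k)" using p by simp
    finally have f: "bernoulli_weight p {a :: nat ^ 'd. \<forall>i. a $ i \<le> x $ i} (\<lambda>F. x \<notin> subset_sums F) \<le> 2 * (exp (- k) * exp (- k))"
      by (simp add: mult_exp_exp)
    have a: "exp (- real k) \<le> p ^ 10"
      unfolding pe using k10 by (simp add: exp_of_nat_mult[symmetric])
    have "w\<^sup>2 \<le> ((real k + 1) ^ (?d + 1))\<^sup>2" using wk \<open>0 < w\<close> by (intro power_mono) auto
    also have "\<dots> = (real k + 1) ^ m" unfolding m_def power_mult[symmetric] by (simp add: mult.commute)
    also have "\<dots> \<le> real m ^ m * exp (real k + 1)" by (rule power_le_exp) (auto simp: m_def)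
    also have "\<dots> = C1 * exp k" by (simp add: C1_def exp_add)
    finally have b: "exp (- real k) \<le> C1 / w\<^sup>2"
      using \<open>0 < w\<close> by (simp add: exp_minus field_simps)
    have "2 * (exp (- real k) * exp (- k)) \<le> 2 * (p ^ 10 * (C1 / w\<^sup>2))"
      using a b p by (intro mult_left_mono mult_mono) auto
    also have "\<dots> = 2 * C1 * M\<^sup>2 * p ^ 8 / y ^ 2"
      using p M \<open>0 < w\<close> by (simp add: w_def field_simps power_mult_distrib) (simp add: power_def numeral_eq_Suc)
    finally show ?thesis using f by (simp add: y_def L_def)
  qed
  show ?thesis
    by (rule exI[of _ C], intro conjI C, rule exI[of _ "2 * C1 * M\<^sup>2"], intro conjI, use C1 M in simp,
        rule exI[of _ L0]) (use main in blast)
qed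

lemma sum_inverse_squares_le: "L \<ge> 1 \<Longrightarrow> (\<Sum>n\<le>N. 1 / (real n + L)\<^sup>2) \<le> 2"
proof -
  assume L: "L \<ge> 1"
  have "(\<Sum>n\<le>N. 1 / (real n + 1)\<^sup>2) \<le> 2 - 1 / (real N + 1)" for N
  proof (induction N)
    case (Suc N)
    have "1 / (real N + 2)\<^sup>2 \<le> 1 / (real N + 1) - 1 / (real N + 2)"
      by (simp add: power2_eq_square divide_simps)
    then show ?case using Suc by (simp add: add_ac)
  qed simp
  moreover have "(\<Sum>n\<le>N. 1 / (real n + L)\<^sup>2) \<le> (\<Sum>n\<le>N. 1 / (real n + 1)\<^sup>2)"
    using L by (intro sum_mono divide_left_mono power_mono mult_pos_pos) auto
  ultimately show ?thesis by (smt (verit) divide_nonneg_nonneg of_nat_0_le_iff)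
qed

lemma sum_inverse_shifted_product_le:
  fixes X :: "(nat ^ 'd) set"
  assumes "L \<ge> 1" "finite X"
  shows "(\<Sum>x\<in>X. 1 / shifted_product L x ^ 2) \<le> 2 ^ CARD('d)"
proof -
  define N where "N = (\<Sum>x\<in>X. \<Sum>i\<in>UNIV. x $ i)"
  have N: "x $ i \<le> N" if "x \<in> X" for x i
  proof -
    have "x $ i \<le> (\<Sum>i\<in>UNIV. x $ i)" by (rule member_le_sum) auto
    also have "\<dots> \<le> N" unfolding N_def using that assms
      by (intro member_le_sum[of x X "\<lambda>x. \<Sum>i\<in>UNIV. x $ i"]) auto
    finally show ?thesis .
  qed
  have "(\<Sum>x\<in>X. 1 / shifted_product L x ^ 2) \<le> (\<Sum>x::nat^'d | \<forall>i. x $ i \<in> {..N}. 1 / shifted_product L x ^ 2)"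
  proof (rule sum_mono2)
    show "finite {x :: nat ^ 'd. \<forall>i. x $ i \<in> {..N}}" by (rule sum_prod_vec_box(1)) simp
  qed (use N in auto)
  also have "\<dots> = (\<Sum>x::nat^'d | \<forall>i. x $ i \<in> {..N}. \<Prod>i\<in>UNIV. 1 / (real (x $ i) + L)\<^sup>2)"
    by (simp add: shifted_product_def prod_dividef prod_power_distrib)
  also have "\<dots> = (\<Prod>i\<in>(UNIV :: 'd set). \<Sum>n\<in>{..N}. 1 / (real n + L)\<^sup>2)"
    by (rule sum_prod_vec_box(2)) auto
  also have "\<dots> \<le> (\<Prod>i\<in>(UNIV :: 'd set). 2)"
    using sum_inverse_squares_le[OF assms(1)] by (intro prod_mono) (auto intro!: sum_nonneg)
  finally show ?thesis by simp
qed

text \<open>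
  Union bound over all \<open>x\<close>. Instead of the failure event itself a measurable set \<open>N\<close> containing it is
  provided: each failure at \<open>x\<close> is weakened to an event about the finitely many vectors below \<open>x\<close>, and \<open>N\<close> is
  the union of those.
\<close>

lemma covering_probability:
  "\<exists>C\<ge>1. \<exists>K>0. \<forall>\<^sub>F p in at_right 0. \<exists>N\<in>sets (coin_flips p). measure (coin_flips p) N \<le> K * p ^ 8 \<and>
     (\<forall>\<omega>. \<omega> \<notin> N \<longrightarrow> UNIV - region p (C * (1 / p) * ln (1 / p) ^ (CARD('d) + 1))
       \<subseteq> subset_sums {x :: nat ^ 'd. \<omega> x})"
proof -
  from uncovered_decay[where 'd = 'd] obtain C K L0 where C: "C \<ge> 1" and K: "K > 0"
    and "\<forall>p. \<forall>x :: nat ^ 'd. 0 < p \<longrightarrow> p < 1 \<longrightarrow> L0 \<le> ln (1 / p) \<longrightarrow>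
     C * (1 / p) * ln (1 / p) ^ (CARD('d) + 1) < shifted_product (ln (1 / p)) x \<longrightarrow>
     bernoulli_weight p {a :: nat ^ 'd. \<forall>i. a $ i \<le> x $ i} (\<lambda>F. x \<notin> subset_sums F)
       \<le> K * p ^ 8 / shifted_product (ln (1 / p)) x ^ 2"
    by (elim exE conjE) (rule that)
  note decay = this(3)[rule_format]
  have "\<exists>N\<in>sets (coin_flips p). measure (coin_flips p) N \<le> (K * 2 ^ CARD('d)) * p ^ 8 \<and>
     (\<forall>\<omega>. \<omega> \<notin> N \<longrightarrow> UNIV - region p (C * (1 / p) * ln (1 / p) ^ (CARD('d) + 1))
       \<subseteq> subset_sums {x :: nat ^ 'd. \<omega> x})"
    if p: "0 < p" "p < 1" and L0: "max 1 L0 \<le> ln (1 / p)" for p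
  proof -
    define L where "L = ln (1 / p)"
    define R :: "(nat ^ 'd) set" where "R = region p (C * (1 / p) * ln (1 / p) ^ (CARD('d) + 1))"
    define bad where "bad x = {\<omega>. x \<notin> R \<and> x \<notin> subset_sums ({x :: nat ^ 'd. \<omega> x} \<inter> {a :: nat ^ 'd. \<forall>i. a $ i \<le> x $ i})}" for x
    interpret prob_space "coin_flips p :: (nat ^ 'd \<Rightarrow> bool) measure" by (rule prob_space_coin_flips)
    have L: "L \<ge> 1" "L0 \<le> ln (1 / p)" using L0 by (auto simp: L_def)
    have fin: "finite {a :: nat ^ 'd. \<forall>i. a $ i \<le> x $ i}" for x
      by (rule finite_box)
    have meas: "bad x \<in> sets (coin_flips p)" for x
      unfolding bad_def using coin_flips_local_event(1)[OF fin[of x], of p "\<lambda>F. x \<notin> R \<and> x \<notin> subset_sums F"] p by simp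
    have le: "measure (coin_flips p) (bad x) \<le> K * p ^ 8 * (1 / shifted_product L x ^ 2)" for x
    proof (cases "x \<in> R")
      case True
      then show ?thesis using K p by (simp add: bad_def)
    next
      case False
      then have "bad x = {\<omega>. x \<notin> subset_sums ({x :: nat ^ 'd. \<omega> x} \<inter> {a :: nat ^ 'd. \<forall>i. a $ i \<le> x $ i})}"
        by (simp add: bad_def)
      also have "measure (coin_flips p) \<dots> = bernoulli_weight p {a :: nat ^ 'd. \<forall>i. a $ i \<le> x $ i} (\<lambda>F. x \<notin> subset_sums F)"
        using p by (intro coin_flips_local_event(2)[OF fin]) auto
      also have "\<dots> \<le> K * p ^ 8 / shifted_product L x ^ 2"
        unfolding L_def using False by (intro decay p L) (auto simp: R_def region_alt)
      finally show ?thesis by simp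
    qed
    define e where "e = from_nat_into (UNIV :: (nat ^ 'd) set)"
    have "infinite (UNIV :: (nat ^ 'd) set)"
    proof
      assume "finite (UNIV :: (nat ^ 'd) set)"
      then have "finite (range (\<lambda>n::nat. (\<chi> i. n) :: nat ^ 'd))" by (rule finite_subset[rotated]) auto
      moreover have "inj (\<lambda>n::nat. (\<chi> i. n) :: nat ^ 'd)" by (auto simp: inj_def vec_eq_iff)
      ultimately show False by (auto dest: finite_imageD)
    qed
    then have e: "bij e" unfolding e_def by (intro bij_betw_from_nat_into) auto
    have bound: "(\<Sum>n<N. measure (coin_flips p) (bad (e n))) \<le> K * p ^ 8 * 2 ^ CARD('d)" for N
    proof -
      have "(\<Sum>n<N. measure (coin_flips p) (bad (e n))) \<le> (\<Sum>n<N. K * p ^ 8 * (1 / shifted_product L (e n) ^ 2))"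
        by (intro sum_mono le)
      also have "\<dots> = K * p ^ 8 * (\<Sum>x\<in>e ` {..<N}. 1 / shifted_product L x ^ 2)"
        using e by (subst sum.reindex) (auto simp: sum_distrib_left bij_def intro: inj_on_subset)
      also have "\<dots> \<le> K * p ^ 8 * 2 ^ CARD('d)"
        using K p L by (intro mult_left_mono sum_inverse_shifted_product_le) auto
      finally show ?thesis .
    qed
    have summ: "summable (\<lambda>n. measure (coin_flips p) (bad (e n)))"
      using bound by (intro summableI_nonneg_bounded) auto
    show ?thesis
    proof (intro bexI[of _ "\<Union>n. bad (e n)"] conjI allI impI)
      have "measure (coin_flips p) (\<Union>n. bad (e n)) \<le> (\<Sum>n. measure (coin_flips p) (bad (e n)))"
        using meas summ by (intro finite_measure_subadditive_countably) auto
      also have "\<dots> \<le> K * p ^ 8 * 2 ^ CARD('d)" by (rule suminf_le_const[OF summ bound])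
      finally show "measure (coin_flips p) (\<Union>n. bad (e n)) \<le> (K * 2 ^ CARD('d)) * p ^ 8" by (simp add: mult_ac)
      fix \<omega> assume \<omega>: "\<omega> \<notin> (\<Union>n. bad (e n))"
      have "x \<in> subset_sums {x :: nat ^ 'd. \<omega> x}" if "x \<notin> R" for x
      proof -
        obtain n where "x = e n" using e by (meson bij_pointE)
        then have "x \<in> subset_sums ({x :: nat ^ 'd. \<omega> x} \<inter> {a. \<forall>i. a $ i \<le> x $ i})"
          using \<omega> that by (auto simp: bad_def)
        then show ?thesis
          using subset_sums_mono[of "{x. \<omega> x} \<inter> {a. \<forall>i. a $ i \<le> x $ i}" "{x. \<omega> x}"] by blast
      qed
      then show "UNIV - region p (C * (1 / p) * ln (1 / p) ^ (CARD('d) + 1)) \<subseteq> subset_sums {x :: nat ^ 'd. \<omega> x}"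
        unfolding R_def by blast
    qed (use meas in auto)
  qed
  then show ?thesis
    using C K by (intro exI[of _ C] conjI exI[of _ "K * 2 ^ CARD('d)"] eventually_small_p[of "max 1 L0"]) auto
qed

section \<open>The size of the region\<close>

lemma card_shifted_nats:
  assumes "1 \<le> L" "0 \<le> w"
  shows "finite {n. real n + L \<le> w}" "real (card {n. real n + L \<le> w}) \<le> w"
    "w - L \<le> real (card {n. real n + L \<le> w})"
proof -
  show "finite {n. real n + L \<le> w}"
    by (rule finite_subset[of _ "{..nat \<lfloor>w\<rfloor>}"]) (use assms in \<open>auto simp: le_nat_floor\<close>)
  show "real (card {n. real n + L \<le> w}) \<le> w" "w - L \<le> real (card {n. real n + L \<le> w})"
  proof -
    have "{n. real n + L \<le> w} = {..nat \<lfloor>w - L\<rfloor>}" if "L \<le> w"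
      using that by (auto simp: le_nat_iff le_floor_iff)
    moreover have "{n. real n + L \<le> w} = {}" if "w < L" using that by auto
    ultimately show "real (card {n. real n + L \<le> w}) \<le> w" "w - L \<le> real (card {n. real n + L \<le> w})"
      using assms by (cases "L \<le> w"; simp; linarith)+
  qed
qed

text \<open>
  Once the other coordinates are fixed, the condition on coordinate \<open>i0\<close> is linear, so the count becomes a
  sum over the other coordinates. They are cut off at \<open>N\<close>: for an upper bound \<open>N\<close> is so large that nothing is
  lost, for a lower bound so small that every slice is long.
\<close>

lemma card_shifted_product_slices:
  fixes i0 :: "'d::finite" and N :: nat
  assumes "1 \<le> L" "0 \<le> Z"
  defines "I \<equiv> UNIV - {i0}"
  defines "X \<equiv> {x :: nat ^ 'd. shifted_product L x \<le> Z \<and> (\<forall>i\<in>I. x $ i \<le> N)}"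
  shows "finite X"
    and "card X = (\<Sum>g\<in>PiE I (\<lambda>_. {..N}). card {n. real n + L \<le> Z / (\<Prod>i\<in>I. real (g i) + L)})"
proof -
  let ?f = "\<lambda>(g, n). \<chi> i. if i = i0 then n else g i"
  let ?Y = "\<lambda>g. {n. real n + L \<le> Z / (\<Prod>i\<in>I. real (g i) + L)}"
  have pos: "0 < (\<Prod>i\<in>I. real (g i) + L)" for g :: "'d \<Rightarrow> nat" using assms by (intro prod_pos) auto
  have split: "shifted_product L x = (real (x $ i0) + L) * (\<Prod>i\<in>I. real (x $ i) + L)" for x :: "nat ^ 'd"
    unfolding shifted_product_def I_def by (rule prod.remove) auto
  have bij: "bij_betw ?f (Sigma (PiE I (\<lambda>_. {..N})) ?Y) X"
  proof (rule bij_betw_byWitness[where f' = "\<lambda>x. (restrict (vec_nth x) I, x $ i0)"])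
    show "\<forall>a\<in>Sigma (PiE I (\<lambda>_. {..N})) ?Y. (restrict (vec_nth (?f a)) I, ?f a $ i0) = a"
      by (auto simp: I_def PiE_iff extensional_def fun_eq_iff)
    show "\<forall>x\<in>X. ?f (restrict (vec_nth x) I, x $ i0) = x"
      by (auto simp: vec_eq_iff I_def)
    show "?f ` Sigma (PiE I (\<lambda>_. {..N})) ?Y \<subseteq> X"
    proof (rule image_subsetI)
      fix a assume "a \<in> Sigma (PiE I (\<lambda>_. {..N})) ?Y"
      then obtain g n where a: "a = (g, n)" and g: "g \<in> PiE I (\<lambda>_. {..N})" and n: "n \<in> ?Y g" by auto
      have "(\<Prod>i\<in>I. real (?f a $ i) + L) = (\<Prod>i\<in>I. real (g i) + L)"
        by (intro prod.cong) (auto simp: I_def a)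
      then show "?f a \<in> X"
        using g n pos[of g] by (auto simp: X_def split a pos_le_divide_eq I_def PiE_iff)
    qed
    show "(\<lambda>x. (restrict (vec_nth x) I, x $ i0)) ` X \<subseteq> Sigma (PiE I (\<lambda>_. {..N})) ?Y"
    proof (rule image_subsetI)
      fix x assume x: "x \<in> X"
      have "(\<Prod>i\<in>I. real (restrict (vec_nth x) I i) + L) = (\<Prod>i\<in>I. real (x $ i) + L)"
        by (intro prod.cong) auto
      then show "(restrict (vec_nth x) I, x $ i0) \<in> Sigma (PiE I (\<lambda>_. {..N})) ?Y"
        using x pos[of "vec_nth x"] by (auto simp: X_def split pos_le_divide_eq simp del: restrict_apply)
    qed
  qed
  have fin: "finite (PiE I (\<lambda>_. {..N}))" "\<And>g. finite (?Y g)"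
    using assms pos by (auto intro!: finite_PiE card_shifted_nats divide_nonneg_pos)
  then show "finite X" using bij_betw_finite[OF bij] by blast
  show "card X = (\<Sum>g\<in>PiE I (\<lambda>_. {..N}). card (?Y g))"
    using bij_betw_same_card[OF bij] fin by (simp add: card_SigmaI)
qed

lemma sum_inverse_le_ln:
  assumes "1 \<le> L"
  shows "(\<Sum>n\<le>N. 1 / (real n + L)) \<le> 1 + ln (real N + 1)"
proof -
  have "(\<Sum>n\<le>N. 1 / (real n + L)) \<le> (\<Sum>n\<le>N. 1 / (real n + 1))"
    using assms by (intro sum_mono divide_left_mono mult_pos_pos) auto
  also have "\<dots> \<le> 1 + ln (real N + 1)"
  proof (induction N)
    case (Suc N)
    have "ln ((real N + 1) / (real N + 2)) \<le> (real N + 1) / (real N + 2) - 1"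
      by (rule ln_le_minus_one) simp
    then have "1 / (real N + 2) \<le> ln (real N + 2) - ln (real N + 1)"
      by (simp add: ln_div field_simps)
    then show ?case using Suc by (simp add: add_ac)
  qed simp
  finally show ?thesis .
qed

lemma ln_le_sum_inverse:
  assumes "1 \<le> L"
  shows "ln ((real N + 1 + L) / L) \<le> (\<Sum>n\<le>N. 1 / (real n + L))"
proof (induction N)
  case 0
  have "ln ((1 + L) / L) \<le> (1 + L) / L - 1" using assms by (intro ln_le_minus_one) simp
  then show ?case using assms by (simp add: field_simps)
next
  case (Suc N)
  have "ln ((real N + 2 + L) / (real N + 1 + L)) \<le> (real N + 2 + L) / (real N + 1 + L) - 1"
    using assms by (intro ln_le_minus_one) simp
  also have "\<dots> = 1 / (real N + 1 + L)" using assms by (simp add: field_simps)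
  also have "ln ((real N + 2 + L) / (real N + 1 + L)) = ln ((real N + 2 + L) / L) - ln ((real N + 1 + L) / L)"
    using assms by (simp add: ln_div)
  finally show ?case using Suc by (simp add: add_ac)
qed

lemma sum_slices:
  fixes I :: "'d::finite set"
  shows "(\<Sum>g\<in>PiE I (\<lambda>_. {..N}). Z / (\<Prod>i\<in>I. real (g i) + L)) = Z * (\<Sum>n\<le>N. 1 / (real n + L)) ^ card I"
proof -
  have "(\<Sum>g\<in>PiE I (\<lambda>_. {..N}). Z / (\<Prod>i\<in>I. real (g i) + L))
      = Z * (\<Sum>g\<in>PiE I (\<lambda>_. {..N}). \<Prod>i\<in>I. 1 / (real (g i) + L))"
    by (simp add: sum_distrib_left prod_dividef)
  also have "\<dots> = Z * (\<Prod>i\<in>I. \<Sum>n\<le>N. 1 / (real n + L))"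
    by (subst prod_sum_PiE) auto
  finally show ?thesis by simp
qed

lemma card_shifted_product_upper:
  assumes "1 \<le> L" "0 \<le> Z"
  shows "finite {x :: nat ^ 'd. shifted_product L x \<le> Z}"
    and "real (card {x :: nat ^ 'd. shifted_product L x \<le> Z}) \<le> Z * (1 + ln (Z + 1)) ^ (CARD('d) - 1)"
proof -
  fix i0 :: 'd
  let ?I = "UNIV - {i0}"
  define N where "N = nat \<lfloor>Z\<rfloor>"
  have N: "x $ i \<le> N" if "shifted_product L x \<le> Z" for x :: "nat ^ 'd" and i
    using coordinate_le_shifted_product[OF assms(1), of x i] that assms unfolding N_def by (intro le_nat_floor) linarith
  then have eq: "{x :: nat ^ 'd. shifted_product L x \<le> Z} = {x. shifted_product L x \<le> Z \<and> (\<forall>i\<in>?I. x $ i \<le> N)}"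
    by auto
  show "finite {x :: nat ^ 'd. shifted_product L x \<le> Z}"
    unfolding eq by (rule card_shifted_product_slices[OF assms])
  have pos: "0 < (\<Prod>i\<in>?I. real (g i) + L)" for g :: "'d \<Rightarrow> nat" using assms by (intro prod_pos) auto
  have "real (card {x :: nat ^ 'd. shifted_product L x \<le> Z}) =
      (\<Sum>g\<in>PiE ?I (\<lambda>_. {..N}). real (card {n. real n + L \<le> Z / (\<Prod>i\<in>?I. real (g i) + L)}))"
    unfolding eq card_shifted_product_slices(2)[OF assms] by simp
  also have "\<dots> \<le> (\<Sum>g\<in>PiE ?I (\<lambda>_. {..N}). Z / (\<Prod>i\<in>?I. real (g i) + L))"
    using assms pos by (intro sum_mono card_shifted_nats) (auto intro!: divide_nonneg_pos)
  also have "\<dots> = Z * (\<Sum>n\<le>N. 1 / (real n + L)) ^ card ?I" by (rule sum_slices)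
  also have "\<dots> \<le> Z * (1 + ln (Z + 1)) ^ card ?I"
  proof (intro mult_left_mono power_mono)
    have "real N \<le> Z" using assms by (simp add: N_def)
    then show "(\<Sum>n\<le>N. 1 / (real n + L)) \<le> 1 + ln (Z + 1)"
      using sum_inverse_le_ln[OF assms(1), of N] assms by (smt (verit) ln_le_cancel_iff of_nat_0_le_iff)
  qed (use assms in \<open>auto intro!: sum_nonneg\<close>)
  finally show "real (card {x :: nat ^ 'd. shifted_product L x \<le> Z}) \<le> Z * (1 + ln (Z + 1)) ^ (CARD('d) - 1)"
    by (simp add: card_Diff_singleton)
qed

text \<open>
  The hypothesis on \<open>N\<close> ensures that every slice has length at least \<open>2 L\<close> before the shift by \<open>L\<close> is
  subtracted, so that at least half of it remains.
\<close>

lemma card_shifted_product_lower: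
  assumes "1 \<le> L" "0 \<le> Z" and N: "2 * L * (real N + L) ^ (CARD('d) - 1) \<le> Z"
  shows "Z / 2 * ln ((real N + 1 + L) / L) ^ (CARD('d) - 1) \<le> real (card {x :: nat ^ 'd. shifted_product L x \<le> Z})"
proof -
  fix i0 :: 'd
  let ?I = "UNIV - {i0}"
  have card_I: "card ?I = CARD('d) - 1" by (simp add: card_Diff_singleton)
  have pos: "0 < (\<Prod>i\<in>?I. real (g i) + L)" for g :: "'d \<Rightarrow> nat" using assms by (intro prod_pos) auto
  have "Z / 2 * ln ((real N + 1 + L) / L) ^ (CARD('d) - 1) \<le> Z / 2 * (\<Sum>n\<le>N. 1 / (real n + L)) ^ card ?I"
    unfolding card_I using assms by (intro mult_left_mono power_mono ln_le_sum_inverse) auto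
  also have "\<dots> = (\<Sum>g\<in>PiE ?I (\<lambda>_. {..N}). Z / 2 / (\<Prod>i\<in>?I. real (g i) + L))"
    by (rule sum_slices[symmetric])
  also have "\<dots> \<le> (\<Sum>g\<in>PiE ?I (\<lambda>_. {..N}). real (card {n. real n + L \<le> Z / (\<Prod>i\<in>?I. real (g i) + L)}))"
  proof (rule sum_mono)
    fix g assume g: "g \<in> PiE ?I (\<lambda>_. {..N})"
    let ?w = "Z / (\<Prod>i\<in>?I. real (g i) + L)"
    have "(\<Prod>i\<in>?I. real (g i) + L) \<le> (\<Prod>i\<in>?I. real N + L)"
      using g assms by (intro prod_mono) (auto simp: PiE_iff)
    then have "2 * L * (\<Prod>i\<in>?I. real (g i) + L) \<le> 2 * L * (real N + L) ^ (CARD('d) - 1)"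
      unfolding card_I[symmetric] using assms by (intro mult_left_mono) auto
    then have "2 * L \<le> ?w" using N pos[of g] by (simp add: pos_le_divide_eq)
    then have "Z / 2 / (\<Prod>i\<in>?I. real (g i) + L) \<le> ?w - L" by simp
    also have "\<dots> \<le> real (card {n. real n + L \<le> ?w})"
      using assms pos[of g] by (intro card_shifted_nats divide_nonneg_pos) auto
    finally show "Z / 2 / (\<Prod>i\<in>?I. real (g i) + L) \<le> real (card {n. real n + L \<le> ?w})" .
  qed
  also have "\<dots> = real (card {x :: nat ^ 'd. shifted_product L x \<le> Z \<and> (\<forall>i\<in>?I. x $ i \<le> N)})"
    unfolding card_shifted_product_slices(2)[OF assms(1,2)] by simp
  also have "\<dots> \<le> real (card {x :: nat ^ 'd. shifted_product L x \<le> Z})"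
    using card_shifted_product_upper(1)[OF assms(1,2)] by (intro of_nat_mono card_mono) auto
  finally show ?thesis .
qed

text \<open>
  Both harmonic sums over a coordinate are of order \<open>L = ln (1 / p)\<close>: from above because coordinates in the
  region are at most \<open>Z\<close> and \<open>ln Z \<approx> L\<close>, from below already when the coordinates are cut off at
  \<open>p\<^bsup>-1/(2d)\<^esup>\<close>. That cut-off keeps the product of the \<open>d - 1\<close> other coordinates below about \<open>p\<^bsup>-1/2\<^esup>\<close>,
  so the slices are long.
\<close>

lemma card_region_asymp:
  assumes "K > 0"
  shows "\<exists>a>0. \<exists>b>0. \<forall>\<^sub>F p in at_right 0.
    finite (region p (K * (1 / p) * ln (1 / p) ^ (CARD('d) + 1)) :: (nat ^ 'd) set) \<and>
    a * ((1 / p) * ln (1 / p) ^ (2 * CARD('d))) \<le> real (card (region p (K * (1 / p) * ln (1 / p) ^ (CARD('d) + 1)) :: (nat ^ 'd) set)) \<and>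
    real (card (region p (K * (1 / p) * ln (1 / p) ^ (CARD('d) + 1)) :: (nat ^ 'd) set)) \<le> b * ((1 / p) * ln (1 / p) ^ (2 * CARD('d)))"
proof -
  let ?d = "CARD('d)"
  have d: "0 < real ?d" by simp
  define a where "a = K / 2 / (4 * real ?d) ^ (?d - 1)"
  define b where "b = K * 2 ^ (?d - 1)"
  have ab: "a > 0" "b > 0" using assms d by (auto simp: a_def b_def)
  have "eventually (\<lambda>L::real. 1 + ln 2 + ln K + L + (real ?d + 1) * ln L \<le> 2 * L) at_top"
    by real_asymp
  moreover have "eventually (\<lambda>L::real. 1 \<le> K * exp L) at_top"
    using assms by real_asymp
  moreover have "eventually (\<lambda>L::real. 2 * 2 ^ (?d - 1) \<le> K * exp (L / 2)) at_top"
    using assms by real_asymp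
  moreover have "eventually (\<lambda>L::real. L \<le> exp (L / (2 * real ?d))) at_top"
    using d by real_asymp
  moreover have "eventually (\<lambda>L::real. ln L \<le> L / (4 * real ?d)) at_top"
    using d by real_asymp
  moreover have "eventually (\<lambda>L::real. 1 \<le> L) at_top" by (rule eventually_ge_at_top)
  ultimately have "eventually (\<lambda>L. 1 + ln 2 + ln K + L + (real ?d + 1) * ln L \<le> 2 * L \<and> 1 \<le> K * exp L \<and>
      2 * 2 ^ (?d - 1) \<le> K * exp (L / 2) \<and> L \<le> exp (L / (2 * real ?d)) \<and> ln L \<le> L / (4 * real ?d) \<and> 1 \<le> L) at_top"
    by eventually_elim blast
  then obtain L0 where L0: "\<And>L. L0 \<le> L \<Longrightarrow> 1 + ln 2 + ln K + L + (real ?d + 1) * ln L \<le> 2 * L \<and> 1 \<le> K * exp L \<and>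
      2 * 2 ^ (?d - 1) \<le> K * exp (L / 2) \<and> L \<le> exp (L / (2 * real ?d)) \<and> ln L \<le> L / (4 * real ?d) \<and> 1 \<le> L"
    by (auto simp: eventually_at_top_linorder)
  have main: "finite (region p (K * (1 / p) * ln (1 / p) ^ (?d + 1)) :: (nat ^ 'd) set) \<and>
    a * ((1 / p) * ln (1 / p) ^ (2 * ?d)) \<le> real (card (region p (K * (1 / p) * ln (1 / p) ^ (?d + 1)) :: (nat ^ 'd) set)) \<and>
    real (card (region p (K * (1 / p) * ln (1 / p) ^ (?d + 1)) :: (nat ^ 'd) set)) \<le> b * ((1 / p) * ln (1 / p) ^ (2 * ?d))"
    if p: "0 < p" "p < 1" and "L0 \<le> ln (1 / p)" for p
  proof -
    define L where "L = ln (1 / p)"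
    define Z where "Z = K * (1 / p) * L ^ (?d + 1)"
    note L = L0[OF that(3), folded L_def]
    have pL: "1 / p = exp L" using p by (simp add: L_def)
    have dsplit: "2 * ?d = (?d + 1) + (?d - 1)" by (simp add: Suc_leI)
    have Z1: "1 \<le> Z"
    proof -
      have "1 * 1 \<le> (K * exp L) * L ^ (?d + 1)" using L one_le_power[of L "?d + 1"] by (intro mult_mono) auto
      then show ?thesis by (simp add: Z_def pL)
    qed
    have lnZ: "1 + ln (Z + 1) \<le> 2 * L"
    proof -
      have "ln (Z + 1) \<le> ln (2 * Z)" using Z1 by (subst ln_le_cancel_iff) auto
      also have "\<dots> = ln 2 + ln K + L + (real ?d + 1) * ln L"
        using assms L unfolding Z_def pL by (simp add: ln_mult ln_realpow algebra_simps)
      finally show ?thesis using L by linarith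
    qed
    define N where "N = nat \<lfloor>exp (L / (2 * real ?d))\<rfloor>"
    have N: "real N \<le> exp (L / (2 * real ?d))" "exp (L / (2 * real ?d)) \<le> real N + 1"
      unfolding N_def by (auto simp: less_imp_le)
    have "2 * L * (real N + L) ^ (?d - 1) \<le> 2 * L * (2 * exp (L / (2 * real ?d))) ^ (?d - 1)"
      using N L by (intro mult_left_mono power_mono) auto
    also have "\<dots> = 2 * 2 ^ (?d - 1) * L * exp (real (?d - 1) * (L / (2 * real ?d)))"
      unfolding power_mult_distrib exp_of_nat_mult by simp
    also have "\<dots> \<le> 2 * 2 ^ (?d - 1) * L * exp (L / 2)"
    proof -
      have "real (?d - 1) * (L / (2 * real ?d)) \<le> real ?d * (L / (2 * real ?d))"
        using L by (intro mult_right_mono) auto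
      then show ?thesis using L by (intro mult_left_mono) auto
    qed
    also have "\<dots> \<le> (K * exp (L / 2)) * L * exp (L / 2)"
      using L by (intro mult_right_mono) auto
    also have "\<dots> = K * exp L * L ^ 1" by (simp add: mult_exp_exp)
    also have "\<dots> \<le> K * exp L * L ^ (?d + 1)"
      using L assms by (intro mult_left_mono power_increasing) auto
    also have "\<dots> = Z" by (simp add: Z_def pL)
    finally have NZ: "2 * L * (real N + L) ^ (?d - 1) \<le> Z" .
    have lower_ln: "L / (4 * real ?d) \<le> ln ((real N + 1 + L) / L)"
    proof -
      have "L / (4 * real ?d) \<le> L / (2 * real ?d) - ln L" using L by (simp add: field_simps)
      also have "\<dots> = ln (exp (L / (2 * real ?d)) / L)" using L by (simp add: ln_div)
      also have "\<dots> \<le> ln ((real N + 1 + L) / L)"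
      proof -
        have "0 < exp (L / (2 * real ?d)) / L" using L by simp
        moreover have "exp (L / (2 * real ?d)) / L \<le> (real N + 1 + L) / L"
          using N L by (intro divide_right_mono) auto
        ultimately show ?thesis by simp
      qed
      finally show ?thesis .
    qed
    have reg: "region p (K * (1 / p) * ln (1 / p) ^ (?d + 1)) = {x :: nat ^ 'd. shifted_product L x \<le> Z}"
      by (simp add: region_alt L_def Z_def)
    have "a * ((1 / p) * L ^ (2 * ?d)) = Z / 2 * (L / (4 * real ?d)) ^ (?d - 1)"
      unfolding dsplit power_add Z_def a_def by (simp add: power_divide mult_ac)
    also have "\<dots> \<le> Z / 2 * ln ((real N + 1 + L) / L) ^ (?d - 1)"
      using lower_ln L Z1 by (intro mult_left_mono power_mono) auto
    also have "\<dots> \<le> real (card {x :: nat ^ 'd. shifted_product L x \<le> Z})"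
      using L Z1 NZ by (intro card_shifted_product_lower) auto
    finally have lo: "a * ((1 / p) * L ^ (2 * ?d)) \<le> real (card {x :: nat ^ 'd. shifted_product L x \<le> Z})" .
    have "real (card {x :: nat ^ 'd. shifted_product L x \<le> Z}) \<le> Z * (1 + ln (Z + 1)) ^ (?d - 1)"
      using L Z1 by (intro card_shifted_product_upper) auto
    also have "\<dots> \<le> Z * (2 * L) ^ (?d - 1)"
      using lnZ Z1 by (intro mult_left_mono power_mono) auto
    also have "\<dots> = b * ((1 / p) * L ^ (2 * ?d))"
      unfolding dsplit power_add Z_def b_def by (simp add: power_mult_distrib mult_ac)
    finally have hi: "real (card {x :: nat ^ 'd. shifted_product L x \<le> Z}) \<le> b * ((1 / p) * L ^ (2 * ?d))" .
    have "finite {x :: nat ^ 'd. shifted_product L x \<le> Z}"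
      using L Z1 by (intro card_shifted_product_upper) auto
    then show ?thesis using lo hi unfolding reg by (simp add: L_def)
  qed
  show ?thesis
    by (rule exI[of _ a], intro conjI ab, rule exI[of _ b], intro conjI ab, rule eventually_small_p[of L0]) (rule main)
qed

section \<open>The expected number of subset sums in the region\<close>

lemma geometric_sum_le:
  assumes "0 < t"
  shows "(\<Sum>n\<le>N. exp (- t * real n)) \<le> 1 + 1 / t"
proof -
  define q where "q = exp (- t)"
  have q: "0 < q" "q < 1" using assms by (auto simp: q_def)
  have "1 + t \<le> exp t" by simp
  then have "q * (1 + t) \<le> 1" by (simp add: q_def exp_minus field_simps)
  then have "1 / (1 - q) \<le> 1 + 1 / t" using q assms by (simp add: field_simps)
  moreover have "(\<Sum>n\<le>N. exp (- t * real n)) = (\<Sum>n<Suc N. q ^ n)"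
    unfolding lessThan_Suc_atMost q_def by (simp add: exp_of_nat_mult[symmetric] mult.commute)
  moreover have "\<dots> = (1 - q ^ Suc N) / (1 - q)" using q one_diff_power_eq[of q "Suc N"] by (simp add: field_simps del: sum.lessThan_Suc power_Suc)
  moreover have "\<dots> \<le> 1 / (1 - q)" using q by (intro divide_right_mono) auto
  ultimately show ?thesis by linarith
qed

text \<open>
  An exponential-moment bound. The event \<open>x \<in> subset_sums A\<close> is a union over the sets \<open>F\<close> with sum \<open>x\<close>, each
  contained in \<open>A\<close> with probability \<open>p\<^bsup>|F|\<^esup>\<close>. Every such \<open>F\<close> consists of vectors below \<open>x\<close>. Multiplying its
  contribution by \<open>exp (t \<cdot> (c - x)) \<ge> 1\<close> and then dropping the condition that the sum of \<open>F\<close> lies in the box leaves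
  a sum over all subsets of the box, which factorises over the vectors. Summing over all \<open>x\<close> in the box costs nothing
  here, and this is essential: bounding the probability of each \<open>x\<close> separately in this way would not even give a
  value below one.
\<close>

lemma expected_subset_sums_in_box:
  fixes c :: "nat ^ 'd" and t :: "'d \<Rightarrow> real"
  assumes p: "0 \<le> p" "p \<le> 1" and t: "\<And>i. 0 < t i"
  defines "B \<equiv> {x. \<forall>i. x $ i \<le> c $ i}"
  shows "(\<Sum>x\<in>B. measure (coin_flips p) {\<omega>. x \<in> subset_sums {a. \<omega> a}})
    \<le> exp ((\<Sum>i\<in>UNIV. t i * real (c $ i)) + p * (\<Prod>i\<in>UNIV. 1 + 1 / t i))"
proof -
  interpret prob_space "coin_flips p :: (nat ^ 'd \<Rightarrow> bool) measure" by (rule prob_space_coin_flips)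
  have B: "B = {x. \<forall>i. x $ i \<in> {..c $ i}}" by (simp add: B_def)
  have fin: "finite B" unfolding B by (rule sum_prod_vec_box(1)) simp
  define q where "q a = p * exp (- (\<Sum>i\<in>UNIV. t i * real (a $ i)))" for a :: "nat ^ 'd"
  define E where "E = exp (\<Sum>i\<in>UNIV. t i * real (c $ i))"
  have q: "0 \<le> q a" for a using p by (simp add: q_def)
  have prob: "measure (coin_flips p) {\<omega>. x \<in> subset_sums {a. \<omega> a}} \<le> (\<Sum>F\<in>{F \<in> Pow B. \<Sum>F = x}. E * (\<Prod>a\<in>F. q a))"
    if x: "x \<in> B" for x
  proof -
    have FB: "F \<subseteq> B" if F: "finite F" "\<Sum>F = x" for F
    proof
      fix a assume a: "a \<in> F"
      have "a $ i \<le> c $ i" for i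
      proof -
        have "a $ i \<le> (\<Sum>a\<in>F. a $ i)" using a F by (intro member_le_sum) auto
        also have "\<dots> = \<Sum>F $ i" by simp
        also have "\<dots> = x $ i" using F(2) by (rule arg_cong)
        also have "\<dots> \<le> c $ i" using x by (simp add: B_def)
        finally show ?thesis .
      qed
      then show "a \<in> B" by (simp add: B_def)
    qed
    have sub: "{\<omega>. x \<in> subset_sums {a. \<omega> a}} \<subseteq> (\<Union>F\<in>{F \<in> Pow B. \<Sum>F = x}. {\<omega>. F \<subseteq> {a. \<omega> a}})"
      using FB by (auto simp: subset_sums_def)
    have finF: "finite F" if "F \<in> {F \<in> Pow B. \<Sum>F = x}" for F using that fin by (auto intro: finite_subset)
    have "measure (coin_flips p) {\<omega>. x \<in> subset_sums {a. \<omega> a}} \<le>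
        measure (coin_flips p) (\<Union>F\<in>{F \<in> Pow B. \<Sum>F = x}. {\<omega>. F \<subseteq> {a. \<omega> a}})"
      using finF p fin by (intro finite_measure_mono[OF sub] sets.finite_UN coin_flips_contains) auto
    also have "\<dots> \<le> (\<Sum>F\<in>{F \<in> Pow B. \<Sum>F = x}. measure (coin_flips p) {\<omega>. F \<subseteq> {a. \<omega> a}})"
      using finF p fin by (intro finite_measure_subadditive_finite) (auto intro!: coin_flips_contains)
    also have "\<dots> \<le> (\<Sum>F\<in>{F \<in> Pow B. \<Sum>F = x}. E * (\<Prod>a\<in>F. q a))"
    proof (rule sum_mono)
      fix F assume F: "F \<in> {F \<in> Pow B. \<Sum>F = x}"
      have "(\<Prod>a\<in>F. q a) = p ^ card F * exp (- (\<Sum>a\<in>F. \<Sum>i\<in>UNIV. t i * real (a $ i)))"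
        using finF[OF F] by (simp add: q_def prod.distrib exp_sum[symmetric] sum_negf)
      also have "(\<Sum>a\<in>F. \<Sum>i\<in>UNIV. t i * real (a $ i)) = (\<Sum>i\<in>UNIV. t i * real (x $ i))"
      proof (subst sum.swap, rule sum.cong)
        fix i
        have "\<Sum>F $ i = (\<Sum>a\<in>F. a $ i)" by simp
        moreover have "\<Sum>F = x" using F by blast
        ultimately have "x $ i = (\<Sum>a\<in>F. a $ i)" by simp
        then show "(\<Sum>a\<in>F. t i * real (a $ i)) = t i * real (x $ i)" by (simp add: sum_distrib_left)
      qed simp
      finally have prod_q: "(\<Prod>a\<in>F. q a) = p ^ card F * exp (- (\<Sum>i\<in>UNIV. t i * real (x $ i)))" .
      have "(\<Sum>i\<in>UNIV. t i * real (x $ i)) \<le> (\<Sum>i\<in>UNIV. t i * real (c $ i))"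
        using t x by (intro sum_mono mult_left_mono) (auto simp: B_def less_imp_le)
      then have "1 \<le> E * exp (- (\<Sum>i\<in>UNIV. t i * real (x $ i)))" by (simp add: E_def mult_exp_exp)
      then have "p ^ card F * 1 \<le> p ^ card F * (E * exp (- (\<Sum>i\<in>UNIV. t i * real (x $ i))))"
        using p by (intro mult_left_mono) auto
      then show "measure (coin_flips p) {\<omega>. F \<subseteq> {a. \<omega> a}} \<le> E * (\<Prod>a\<in>F. q a)"
        using coin_flips_contains(2)[OF finF[OF F] p] by (simp add: prod_q mult_ac)
    qed
    finally show ?thesis .
  qed
  have "(\<Sum>x\<in>B. measure (coin_flips p) {\<omega>. x \<in> subset_sums {a. \<omega> a}})
      \<le> (\<Sum>x\<in>B. \<Sum>F\<in>{F \<in> Pow B. \<Sum>F = x}. E * (\<Prod>a\<in>F. q a))"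
    by (rule sum_mono[OF prob])
  also have "\<dots> = (\<Sum>x\<in>B. \<Sum>F\<in>{F \<in> {F \<in> Pow B. \<Sum>F \<in> B}. \<Sum>F = x}. E * (\<Prod>a\<in>F. q a))"
    by (intro sum.cong) auto
  also have "\<dots> = (\<Sum>F\<in>{F \<in> Pow B. \<Sum>F \<in> B}. E * (\<Prod>a\<in>F. q a))"
    by (rule sum.group) (use fin in auto)
  also have "\<dots> \<le> (\<Sum>F\<in>Pow B. E * (\<Prod>a\<in>F. q a))"
    using fin q by (intro sum_mono2) (auto simp: E_def intro!: mult_nonneg_nonneg prod_nonneg)
  also have "\<dots> = E * (\<Prod>a\<in>B. q a + 1)"
    by (subst prod_add[OF fin]) (simp add: sum_distrib_left)
  also have "\<dots> \<le> E * (\<Prod>a\<in>B. exp (q a))"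
    using q by (intro mult_left_mono prod_mono) (auto simp: E_def add.commute intro: add_nonneg_nonneg exp_ge_add_one_self)
  also have "\<dots> = E * exp (\<Sum>a\<in>B. q a)" using fin by (simp add: exp_sum)
  also have "\<dots> \<le> E * exp (p * (\<Prod>i\<in>UNIV. 1 + 1 / t i))"
  proof -
    have "(\<Sum>a\<in>B. q a) = p * (\<Sum>a\<in>B. \<Prod>i\<in>UNIV. exp (- t i * real (a $ i)))"
      unfolding q_def sum_distrib_left by (simp add: exp_sum sum_negf[symmetric])
    also have "(\<Sum>a\<in>B. \<Prod>i\<in>UNIV. exp (- t i * real (a $ i))) = (\<Prod>i\<in>UNIV. \<Sum>n\<in>{..c $ i}. exp (- t i * real n))"
      unfolding B by (rule sum_prod_vec_box(2)) simp
    also have "p * \<dots> \<le> p * (\<Prod>i\<in>UNIV. 1 + 1 / t i)"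
      using p geometric_sum_le[OF t] by (intro mult_left_mono prod_mono) (auto intro!: sum_nonneg)
    finally show ?thesis by (simp add: E_def)
  qed
  finally show ?thesis by (simp add: E_def exp_add)
qed

text \<open>
  The choice \<open>t\<^sub>i = L / (4 d (c\<^sub>i + L))\<close> makes the linear term at most \<open>L / 4\<close>; the hypothesis on \<open>c\<close> is
  what the product term needs to be at most \<open>L / 4\<close> as well.
\<close>

lemma expected_subset_sums_in_box_le_exp:
  fixes c :: "nat ^ 'd"
  assumes p: "0 < p" "p < 1" and L: "L = ln (1 / p)"
    and c: "shifted_product L c * (4 * (5 * real CARD('d)) ^ CARD('d)) \<le> (1 / p) * L ^ (CARD('d) + 1)"
  shows "(\<Sum>x\<in>{x. \<forall>i. x $ i \<le> c $ i}. measure (coin_flips p) {\<omega>. x \<in> subset_sums {a. \<omega> a}}) \<le> exp (L / 2)"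
proof -
  let ?d = "real CARD('d)"
  define t where "t i = L / (4 * ?d * (real (c $ i) + L))" for i
  have Lpos: "0 < L" using p by (simp add: L)
  have d: "1 \<le> ?d" by (simp add: Suc_leI)
  have t: "0 < t i" for i using Lpos d unfolding t_def by (intro divide_pos_pos mult_pos_pos) auto
  have "(\<Sum>x\<in>{x. \<forall>i. x $ i \<le> c $ i}. measure (coin_flips p) {\<omega>. x \<in> subset_sums {a. \<omega> a}})
      \<le> exp ((\<Sum>i\<in>UNIV. t i * real (c $ i)) + p * (\<Prod>i\<in>UNIV. 1 + 1 / t i))"
    using p t by (intro expected_subset_sums_in_box) auto
  also have "\<dots> \<le> exp (L / 4 + L / 4)"
  proof -
    have "(\<Sum>i\<in>UNIV. t i * real (c $ i)) \<le> (\<Sum>i\<in>(UNIV :: 'd set). L / (4 * ?d))"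
    proof (rule sum_mono)
      fix i
      have "t i * real (c $ i) = (L / (4 * ?d)) * (real (c $ i) / (real (c $ i) + L))"
        by (simp add: t_def)
      also have "\<dots> \<le> (L / (4 * ?d)) * 1" using Lpos d by (intro mult_left_mono) auto
      finally show "t i * real (c $ i) \<le> L / (4 * ?d)" by simp
    qed
    also have "\<dots> = L / 4" using d by simp
    finally have 1: "(\<Sum>i\<in>UNIV. t i * real (c $ i)) \<le> L / 4" .
    have "(\<Prod>i\<in>UNIV. 1 + 1 / t i) \<le> (\<Prod>i\<in>UNIV. (5 * ?d) * ((real (c $ i) + L) / L))"
    proof (rule prod_mono)
      fix i
      define r where "r = ?d * ((real (c $ i) + L) / L)"
      have "1 * 1 \<le> r" unfolding r_def using d Lpos by (intro mult_mono) auto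
      moreover have t_r: "1 / t i = 4 * r" by (simp add: t_def r_def)
      moreover have r: "(5 * ?d) * ((real (c $ i) + L) / L) = 5 * r" by (simp add: r_def)
      ultimately show "0 \<le> 1 + 1 / t i \<and> 1 + 1 / t i \<le> (5 * ?d) * ((real (c $ i) + L) / L)"
        unfolding t_r r by auto
    qed
    also have "\<dots> = (5 * ?d) ^ CARD('d) * (shifted_product L c / L ^ CARD('d))"
      by (simp add: prod.distrib prod_dividef shifted_product_def)
    finally have "p * (\<Prod>i\<in>UNIV. 1 + 1 / t i) \<le> p * ((5 * ?d) ^ CARD('d) * (shifted_product L c / L ^ CARD('d)))"
      using p by (intro mult_left_mono) auto
    also have "\<dots> = (shifted_product L c * (4 * (5 * ?d) ^ CARD('d))) * (p / (4 * L ^ CARD('d)))" by simp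
    also have "\<dots> \<le> ((1 / p) * L ^ (CARD('d) + 1)) * (p / (4 * L ^ CARD('d)))"
      using c p Lpos by (intro mult_right_mono) auto
    also have "\<dots> = L / 4" using p Lpos by simp
    finally show ?thesis using 1 by simp
  qed
  finally show ?thesis by simp
qed

lemma exists_dyadic_bound: "\<exists>j. n \<le> 2 ^ j - 1 \<and> 2 ^ j - 1 \<le> 2 * (n::nat)"
proof (cases "n = 0")
  case True
  then show ?thesis by (intro exI[of _ 0]) simp
next
  case False
  then obtain m where "2 ^ m \<le> n" "n < 2 ^ (m + 1)" using ex_power_ivl1[of 2 n] by auto
  then show ?thesis by (intro exI[of _ "m + 1"]) auto
qed

lemma sum_le_sum_cover:
  fixes f :: "'a \<Rightarrow> real"
  assumes "finite R" "finite \<C>" "\<And>c. c \<in> \<C> \<Longrightarrow> finite (B c)" "R \<subseteq> (\<Union>c\<in>\<C>. B c)" "\<And>x. 0 \<le> f x"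
  shows "(\<Sum>x\<in>R. f x) \<le> (\<Sum>c\<in>\<C>. \<Sum>x\<in>B c. f x)"
proof -
  have "(\<Sum>x\<in>R. f x) \<le> (\<Sum>x\<in>R. \<Sum>c\<in>\<C>. if x \<in> B c then f x else 0)"
  proof (rule sum_mono)
    fix x assume "x \<in> R"
    then obtain c where c: "c \<in> \<C>" "x \<in> B c" using assms by auto
    have "(if x \<in> B c then f x else 0) \<le> (\<Sum>c\<in>\<C>. if x \<in> B c then f x else 0)"
      using c assms by (intro member_le_sum) auto
    then show "f x \<le> (\<Sum>c\<in>\<C>. if x \<in> B c then f x else 0)" using c by simp
  qed
  also have "\<dots> = (\<Sum>c\<in>\<C>. \<Sum>x\<in>R. if x \<in> B c then f x else 0)" by (rule sum.swap)
  also have "\<dots> = (\<Sum>c\<in>\<C>. \<Sum>x\<in>{x \<in> R. x \<in> B c}. f x)" using assms by (simp add: sum.inter_filter)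
  also have "\<dots> \<le> (\<Sum>c\<in>\<C>. \<Sum>x\<in>B c. f x)" using assms by (intro sum_mono sum_mono2) auto
  finally show ?thesis .
qed

text \<open>
  Rounding the coordinates of \<open>x\<close> up to numbers of the form \<open>2\<^bsup>j\<^esup> - 1\<close> at most doubles them, so the boxes
  with such corners and with shifted product at most \<open>2\<^bsup>d\<^esup> Z\<close> cover the region. The factor \<open>2\<^bsup>d\<^esup>\<close> explains the
  \<open>10\<close> in place of \<open>5\<close> in the last hypothesis.
\<close>

lemma expected_subset_sums_in_region:
  assumes p: "0 < p" "p < 1" and L: "L = ln (1 / p)" "1 \<le> L" and Z: "0 \<le> Z"
    and fin: "finite {x :: nat ^ 'd. shifted_product L x \<le> Z}"
    and ZL: "Z * (4 * (10 * real CARD('d)) ^ CARD('d)) \<le> (1 / p) * L ^ (CARD('d) + 1)"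
  shows "(\<Sum>x\<in>{x :: nat ^ 'd. shifted_product L x \<le> Z}. measure (coin_flips p) {\<omega>. x \<in> subset_sums {a. \<omega> a}})
    \<le> (log 2 (2 ^ CARD('d) * Z + 1) + 1) ^ CARD('d) * exp (L / 2)"
proof -
  let ?d = "CARD('d)"
  define J where "J = nat \<lfloor>log 2 (2 ^ ?d * Z + 1)\<rfloor>"
  define A where "A = (\<lambda>j. 2 ^ j - 1 :: nat) ` {..J}"
  define \<C> where "\<C> = {c :: nat ^ 'd. (\<forall>i. c $ i \<in> A) \<and> shifted_product L c \<le> 2 ^ ?d * Z}"
  have finA: "finite A" by (simp add: A_def)
  have sub: "\<C> \<subseteq> {c. \<forall>i. c $ i \<in> A}" by (auto simp: \<C>_def)
  have finV: "finite {c :: nat ^ 'd. \<forall>i. c $ i \<in> A}" by (rule sum_prod_vec_box(1)) (rule finA)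
  then have fin\<C>: "finite \<C>" using sub by (rule rev_finite_subset)
  have "1 \<le> 2 ^ ?d * Z + 1" using Z by simp
  then have log0: "0 \<le> log 2 (2 ^ ?d * Z + 1)" by (subst zero_le_log_cancel_iff) auto
  have "real (card \<C>) \<le> real (card {c :: nat ^ 'd. \<forall>i. c $ i \<in> A})"
    using card_mono[OF finV sub] by simp
  also have "\<dots> = real (card A) ^ ?d"
    using sum_prod_vec_box(2)[of "\<lambda>i::'d. A" "\<lambda>i n. 1::real"] finA by simp
  also have "\<dots> \<le> (log 2 (2 ^ ?d * Z + 1) + 1) ^ ?d"
  proof (rule power_mono)
    have "card A \<le> J + 1" unfolding A_def using card_image_le[of "{..J}" "\<lambda>j. 2 ^ j - 1 :: nat"] by simp
    then show "real (card A) \<le> log 2 (2 ^ ?d * Z + 1) + 1" using log0 unfolding J_def by linarith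
  qed simp
  finally have card\<C>: "real (card \<C>) \<le> (log 2 (2 ^ ?d * Z + 1) + 1) ^ ?d" .
  have cover: "{x :: nat ^ 'd. shifted_product L x \<le> Z} \<subseteq> (\<Union>c\<in>\<C>. {x. \<forall>i. x $ i \<le> c $ i})"
  proof
    fix x :: "nat ^ 'd" assume x: "x \<in> {x. shifted_product L x \<le> Z}"
    have "\<exists>j. \<forall>i. x $ i \<le> 2 ^ j i - 1 \<and> 2 ^ j i - 1 \<le> 2 * (x $ i)"
      by (rule choice) (use exists_dyadic_bound in blast)
    then obtain j where j: "\<And>i. x $ i \<le> 2 ^ j i - 1 \<and> 2 ^ j i - 1 \<le> 2 * (x $ i)" by blast
    define c :: "nat ^ 'd" where "c = (\<chi> i. 2 ^ j i - 1)"
    have "shifted_product L c \<le> (\<Prod>i\<in>UNIV. 2 * (real (x $ i) + L))"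
      unfolding shifted_product_def
    proof (rule prod_mono)
      fix i
      have "real (c $ i) \<le> real (2 * (x $ i))" using j[of i] unfolding c_def by (simp only: of_nat_le_iff vec_lambda_beta)
      then show "0 \<le> real (c $ i) + L \<and> real (c $ i) + L \<le> 2 * (real (x $ i) + L)" using L by simp
    qed
    also have "\<dots> = 2 ^ ?d * shifted_product L x" by (simp only: prod.distrib shifted_product_def) simp
    also have "\<dots> \<le> 2 ^ ?d * Z" using x by simp
    finally have cZ: "shifted_product L c \<le> 2 ^ ?d * Z" .
    have "j i \<le> J" for i
    proof -
      have "real (c $ i) \<le> 2 ^ ?d * Z" using coordinate_le_shifted_product[OF L(2), of c i] cZ L by linarith
      then have "2 ^ j i \<le> 2 ^ ?d * Z + 1" by (simp add: c_def of_nat_diff)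
      then have "2 powr (real (j i)) \<le> 2 ^ ?d * Z + 1" by (simp add: powr_realpow)
      then have "real (j i) \<le> log 2 (2 ^ ?d * Z + 1)" using Z by (simp add: le_log_iff add_nonneg_pos)
      then show ?thesis unfolding J_def by (simp add: le_nat_floor)
    qed
    then have "c \<in> \<C>" using cZ by (auto simp: \<C>_def A_def c_def)
    moreover have "\<forall>i. x $ i \<le> c $ i" using j by (simp add: c_def)
    ultimately show "x \<in> (\<Union>c\<in>\<C>. {x. \<forall>i. x $ i \<le> c $ i})" by blast
  qed
  have "(\<Sum>x\<in>{x :: nat ^ 'd. shifted_product L x \<le> Z}. measure (coin_flips p) {\<omega>. x \<in> subset_sums {a. \<omega> a}})
      \<le> (\<Sum>c\<in>\<C>. \<Sum>x\<in>{x. \<forall>i. x $ i \<le> c $ i}. measure (coin_flips p) {\<omega>. x \<in> subset_sums {a. \<omega> a}})"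
  proof (rule sum_le_sum_cover[OF fin fin\<C> _ cover])
    fix c :: "nat ^ 'd"
    show "finite {x. \<forall>i. x $ i \<le> c $ i}" by (rule finite_box)
  qed simp
  also have "\<dots> \<le> (\<Sum>c\<in>\<C>. exp (L / 2))"
  proof (rule sum_mono, rule expected_subset_sums_in_box_le_exp[OF p L(1)])
    fix c assume "c \<in> \<C>"
    then have "shifted_product L c * (4 * (5 * real ?d) ^ ?d) \<le> (2 ^ ?d * Z) * (4 * (5 * real ?d) ^ ?d)"
      by (intro mult_right_mono) (auto simp: \<C>_def)
    also have "\<dots> = Z * (4 * ((2 * (5 * real ?d)) ^ ?d))" by (simp only: power_mult_distrib mult_ac)
    also have "\<dots> \<le> (1 / p) * L ^ (?d + 1)" using ZL by simp
    finally show "shifted_product L c * (4 * (5 * real ?d) ^ ?d) \<le> (1 / p) * L ^ (?d + 1)" .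
  qed
  also have "\<dots> = real (card \<C>) * exp (L / 2)" by simp
  also have "\<dots> \<le> (log 2 (2 ^ ?d * Z + 1) + 1) ^ ?d * exp (L / 2)"
    using card\<C> by (intro mult_right_mono) auto
  finally show ?thesis .
qed

lemma markov_subset_sums:
  fixes R :: "'a::{countable,comm_monoid_add} set"
  assumes p: "0 \<le> p" "p \<le> 1" and "finite R" and h: "0 < h"
  shows "\<exists>N\<in>sets (coin_flips p).
      measure (coin_flips p) N \<le> (\<Sum>x\<in>R. measure (coin_flips p) {\<omega>. x \<in> subset_sums {a. \<omega> a}}) / h \<and>
      (\<forall>\<omega>. \<omega> \<notin> N \<longrightarrow> real (card (subset_sums {a. \<omega> a} \<inter> R)) \<le> h)"
proof -
  interpret prob_space "coin_flips p :: ('a \<Rightarrow> bool) measure" by (rule prob_space_coin_flips)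
  define u where "u \<omega> = (\<Sum>x\<in>R. indicator {\<omega>. x \<in> subset_sums {a. \<omega> a}} \<omega> :: real)" for \<omega> :: "'a \<Rightarrow> bool"
  have u: "u \<omega> = real (card (subset_sums {a. \<omega> a} \<inter> R))" for \<omega>
    using assms(3) unfolding u_def indicator_def by (simp add: sum.If_cases Int_def conj_commute)
  have int_ind: "integrable (coin_flips p) (indicator {\<omega>. x \<in> subset_sums {a. \<omega> a}} :: _ \<Rightarrow> real)" for x :: 'a
    using sets_subset_sum[OF p] by (intro integrable_real_indicator) (auto simp: emeasure_eq_measure)
  then have int: "integrable (coin_flips p) u" unfolding u_def by (intro Bochner_Integration.integrable_sum)
  have "expectation u = (\<Sum>x\<in>R. measure (coin_flips p) {\<omega>. x \<in> subset_sums {a. \<omega> a}})"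
    unfolding u_def using int_ind by (subst Bochner_Integration.integral_sum) auto
  moreover have "measure (coin_flips p) {\<omega> \<in> space (coin_flips p). h \<le> u \<omega>} \<le> expectation u / h"
    by (rule integral_Markov_inequality_measure[OF int, where A = "{}"]) (use h in \<open>auto simp: u\<close>)
  moreover have "{\<omega> \<in> space (coin_flips p). h \<le> u \<omega>} \<in> sets (coin_flips p)"
    using borel_measurable_integrable[OF int] by measurable
  ultimately show ?thesis
    by (intro bexI[of _ "{\<omega> \<in> space (coin_flips p). h \<le> u \<omega>}"]) (auto simp: u not_le less_imp_le)
qed

text \<open>
  The expectation is at most \<open>p\<^bsup>-5/8\<^esup>\<close>, where \<open>p\<^bsup>-1/2\<^esup>\<close> comes from each box and \<open>p\<^bsup>-1/8\<^esup>\<close> is a generous bound for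
  the number of boxes. The region has at least \<open>a / p\<close> points, so Markov's inequality with the threshold
  \<open>p\<^bsup>1/4\<^esup>\<close> times its size leaves a failure probability of order \<open>p\<^bsup>1/8\<^esup>\<close>.
\<close>

lemma sparsity_probability:
  assumes C: "C \<ge> 1" "C \<ge> 4 * (10 * real CARD('d)) ^ CARD('d)"
  shows "\<exists>K. \<forall>\<^sub>F p in at_right 0. \<exists>N\<in>sets (coin_flips p). measure (coin_flips p) N \<le> K * p powr (1 / 8) \<and>
     (\<forall>\<omega>. \<omega> \<notin> N \<longrightarrow>
       real (card (subset_sums {x :: nat ^ 'd. \<omega> x} \<inter> region p (1 / C * (1 / p) * ln (1 / p) ^ (CARD('d) + 1))))
       \<le> p powr (1 / 4) * real (card (region p (1 / C * (1 / p) * ln (1 / p) ^ (CARD('d) + 1)) :: (nat ^ 'd) set)))"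
proof -
  let ?d = "CARD('d)"
  let ?R = "\<lambda>p. region p (1 / C * (1 / p) * ln (1 / p) ^ (?d + 1)) :: (nat ^ 'd) set"
  have d: "0 < real ?d" by simp
  have "0 < 1 / C" using C by simp
  from card_region_asymp[OF this, where 'd = 'd] obtain a a' where a: "a > 0" and "a' > 0"
    and size: "\<forall>\<^sub>F p in at_right 0. finite (?R p) \<and> a * ((1 / p) * ln (1 / p) ^ (2 * ?d)) \<le> real (card (?R p)) \<and>
      real (card (?R p)) \<le> a' * ((1 / p) * ln (1 / p) ^ (2 * ?d))"
    by (elim exE conjE) (rule that)
  have "eventually (\<lambda>L::real. real ?d + 2 + 2 * (L + (real ?d + 1) * ln L) \<le> exp (L / (8 * real ?d))) at_top"
    using d by real_asymp
  then obtain L0 where L0: "\<And>L::real. L0 \<le> L \<Longrightarrow> real ?d + 2 + 2 * (L + (real ?d + 1) * ln L) \<le> exp (L / (8 * real ?d))"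
    by (auto simp: eventually_at_top_linorder)
  have "eventually (\<lambda>p::real. 0 < p \<and> p < 1 \<and> max 1 L0 \<le> ln (1 / p)) (at_right 0)"
    by (rule eventually_small_p[of "max 1 L0"]) auto
  then have "\<forall>\<^sub>F p in at_right 0. \<exists>N\<in>sets (coin_flips p). measure (coin_flips p) N \<le> 1 / a * p powr (1 / 8) \<and>
     (\<forall>\<omega>. \<omega> \<notin> N \<longrightarrow> real (card (subset_sums {x. \<omega> x} \<inter> ?R p)) \<le> p powr (1 / 4) * real (card (?R p)))"
    using size
  proof eventually_elim
    case (elim p)
    define L where "L = ln (1 / p)"
    define Z where "Z = 1 / C * (1 / p) * L ^ (?d + 1)"
    have p: "0 < p" "p < 1" and L: "1 \<le> L" "L0 \<le> L" using elim by (auto simp: L_def)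
    have pL: "1 / p = exp L" using p by (simp add: L_def)
    have R: "?R p = {x. shifted_product L x \<le> Z}" by (simp add: region_alt L_def Z_def)
    have Zpos: "0 < Z" using C p L by (simp add: Z_def)
    have sizeR: "a * exp L \<le> real (card (?R p))"
    proof -
      have "a * exp L * 1 \<le> a * exp L * L ^ (2 * ?d)"
        using a L by (intro mult_left_mono one_le_power) auto
      also have "\<dots> = a * ((1 / p) * L ^ (2 * ?d))" unfolding pL by (simp only: mult_ac)
      also have "\<dots> \<le> real (card (?R p))" using elim unfolding L_def by blast
      finally show ?thesis by simp
    qed
    then have cardR: "0 < real (card (?R p))" using a by (smt (verit) exp_gt_zero mult_pos_pos)
    have log_le: "log 2 (2 ^ ?d * Z + 1) + 1 \<le> exp (L / (8 * real ?d))"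
    proof -
      have "Z \<le> exp L * L ^ (?d + 1)"
      proof -
        have "Z = (1 / C) * (exp L * L ^ (?d + 1))" by (simp add: Z_def pL)
        also have "\<dots> \<le> 1 * (exp L * L ^ (?d + 1))" using C L by (intro mult_right_mono) auto
        finally show ?thesis by simp
      qed
      moreover have "1 * 1 \<le> exp L * L ^ (?d + 1)"
        using L one_le_power[of L "?d + 1"] by (intro mult_mono) auto
      then have "1 * 1 \<le> 2 ^ ?d * (exp L * L ^ (?d + 1))"
        by (intro mult_mono) auto
      ultimately have "2 ^ ?d * Z + 1 * 1 \<le> 2 ^ ?d * (exp L * L ^ (?d + 1)) + 2 ^ ?d * (exp L * L ^ (?d + 1))"
        by (intro add_mono mult_left_mono) auto
      also have "\<dots> = 2 ^ (?d + 1) * (exp L * L ^ (?d + 1))" by simp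
      finally have "2 ^ ?d * Z + 1 \<le> 2 ^ (?d + 1) * (exp L * L ^ (?d + 1))" by simp
      then have "log 2 (2 ^ ?d * Z + 1) \<le> log 2 (2 ^ (?d + 1) * (exp L * L ^ (?d + 1)))"
        using Zpos L by (subst log_le_cancel_iff) (auto intro: add_pos_pos)
      also have "\<dots> = real (?d + 1) + (L + (real ?d + 1) * ln L) / ln 2"
        using L by (simp add: log_def ln_mult ln_realpow add_divide_distrib algebra_simps)
      also have "(L + (real ?d + 1) * ln L) / ln 2 \<le> (L + (real ?d + 1) * ln L) / (1 / 2)"
        using L ln2_ge_two_thirds by (intro divide_left_mono) (auto intro!: add_nonneg_nonneg mult_nonneg_nonneg)
      finally show ?thesis using L0[OF L(2)] by simp
    qed
    have log0: "0 \<le> log 2 (2 ^ ?d * Z + 1) + 1"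
      using Zpos by (intro add_nonneg_nonneg) (subst zero_le_log_cancel_iff, auto intro: add_pos_pos)
    have "(\<Sum>x\<in>?R p. measure (coin_flips p) {\<omega>. x \<in> subset_sums {a. \<omega> a}})
        \<le> (log 2 (2 ^ ?d * Z + 1) + 1) ^ ?d * exp (L / 2)"
      unfolding R
    proof (rule expected_subset_sums_in_region[OF p L_def L(1)])
      show "finite {x :: nat ^ 'd. shifted_product L x \<le> Z}" using elim unfolding R by blast
      have "Z * (4 * (10 * real ?d) ^ ?d) \<le> Z * C" using C Zpos by (intro mult_left_mono) auto
      also have "\<dots> = (1 / p) * L ^ (?d + 1)" using C by (simp add: Z_def)
      finally show "Z * (4 * (10 * real ?d) ^ ?d) \<le> (1 / p) * L ^ (?d + 1)" .
    qed (use Zpos in auto)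
    also have "\<dots> \<le> exp (L / (8 * real ?d)) ^ ?d * exp (L / 2)"
      using log_le log0 by (intro mult_right_mono power_mono) auto
    also have "\<dots> = exp (5 * L / 8)" by (simp add: exp_of_nat_mult[symmetric] mult_exp_exp)
    finally have total: "(\<Sum>x\<in>?R p. measure (coin_flips p) {\<omega>. x \<in> subset_sums {a. \<omega> a}}) \<le> exp (5 * L / 8)" .
    define h where "h = p powr (1 / 4) * real (card (?R p))"
    have h: "0 < h" using p cardR by (simp add: h_def)
    have ppow: "p powr (1 / 4) = exp (- L / 4)" "p powr (1 / 8) = exp (- L / 8)"
      using p by (auto simp: powr_def L_def ln_div)
    obtain N where N: "N \<in> sets (coin_flips p)"
        "measure (coin_flips p) N \<le> (\<Sum>x\<in>?R p. measure (coin_flips p) {\<omega>. x \<in> subset_sums {a. \<omega> a}}) / h"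
        "\<forall>\<omega>. \<omega> \<notin> N \<longrightarrow> real (card (subset_sums {a. \<omega> a} \<inter> ?R p)) \<le> h"
      using markov_subset_sums[of p "?R p" h] p h elim by auto
    have "measure (coin_flips p) N \<le> exp (5 * L / 8) / h"
      using N(2) total h by (smt (verit) divide_right_mono)
    also have "\<dots> \<le> exp (5 * L / 8) / (exp (- L / 4) * (a * exp L))"
      using sizeR a cardR h unfolding h_def ppow by (intro divide_left_mono mult_left_mono mult_pos_pos) auto
    also have "exp (5 * L / 8) = exp (- L / 8) * (exp (- L / 4) * exp L)" by (simp add: mult_exp_exp)
    also have "\<dots> / (exp (- L / 4) * (a * exp L)) = 1 / a * exp (- L / 8)" by simp
    finally have "measure (coin_flips p) N \<le> 1 / a * p powr (1 / 8)" unfolding ppow .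
    then show ?case using N unfolding h_def by blast
  qed
  then show ?thesis by blast
qed

section \<open>The threshold for subset sums of a random set\<close>

theorem theorem1p3:
  "\<exists>C>0. \<exists>c>0. \<exists>c'>0. \<exists>\<delta> :: real \<Rightarrow> real. (\<delta> \<longlongrightarrow> 0) (at_right 0) \<and>
     with_high_probability (\<lambda>p (A :: (nat ^ 'd) set).
       real (card (subset_sums A \<inter> region p (1 / C * (1 / p) * ln (1 / p) ^ (CARD('d) + 1))))
         \<le> \<delta> p * real (card (region p (1 / C * (1 / p) * ln (1 / p) ^ (CARD('d) + 1)) :: (nat ^ 'd) set)) \<and>
       UNIV - region p (C * (1 / p) * ln (1 / p) ^ (CARD('d) + 1)) \<subseteq> subset_sums A \<and>
       finite (UNIV - subset_sums A) \<and>
       c * ((1 / p) * ln (1 / p) ^ (2 * CARD('d))) \<le> real (card (UNIV - subset_sums A)) \<and>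
       real (card (UNIV - subset_sums A)) \<le> c' * ((1 / p) * ln (1 / p) ^ (2 * CARD('d))))"
proof -
  let ?d = "CARD('d)"
  let ?R = "\<lambda>K p. region p (K * (1 / p) * ln (1 / p) ^ (?d + 1)) :: (nat ^ 'd) set"
  from covering_probability[where 'd = 'd] obtain C1 K1 where C1: "C1 \<ge> 1"
    and cover: "\<forall>\<^sub>F p in at_right 0. \<exists>N\<in>sets (coin_flips p). measure (coin_flips p) N \<le> K1 * p ^ 8 \<and>
     (\<forall>\<omega>. \<omega> \<notin> N \<longrightarrow> UNIV - ?R C1 p \<subseteq> subset_sums {x. \<omega> x})"
    by (elim exE conjE) (rule that)
  (* Enlarging C shrinks both the set that has to be covered and the region that has to be sparse. *)
  define C where "C = max C1 (4 * (10 * real ?d) ^ ?d)"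
  have C: "C \<ge> 1" "C \<ge> C1" "C \<ge> 4 * (10 * real ?d) ^ ?d" using C1 by (auto simp: C_def)
  from sparsity_probability[OF C(1) C(3)] obtain K2
    where sparse: "\<forall>\<^sub>F p in at_right 0. \<exists>N\<in>sets (coin_flips p). measure (coin_flips p) N \<le> K2 * p powr (1 / 8) \<and>
     (\<forall>\<omega>. \<omega> \<notin> N \<longrightarrow> real (card (subset_sums {x. \<omega> x} \<inter> ?R (1 / C) p)) \<le> p powr (1 / 4) * real (card (?R (1 / C) p)))"
    by (elim exE) (rule that)
  have "0 < 1 / C" "0 < C" using C by auto
  from card_region_asymp[OF this(1), where 'd = 'd] obtain a a' where a: "a > 0" and "a' > 0"
    and lower: "\<forall>\<^sub>F p in at_right 0. finite (?R (1 / C) p) \<and> a * ((1 / p) * ln (1 / p) ^ (2 * ?d)) \<le> real (card (?R (1 / C) p)) \<and>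
      real (card (?R (1 / C) p)) \<le> a' * ((1 / p) * ln (1 / p) ^ (2 * ?d))"
    by (elim exE conjE) (rule that)
  from card_region_asymp[OF \<open>0 < C\<close>, where 'd = 'd] obtain b' b where "b' > 0" and b: "b > 0"
    and upper: "\<forall>\<^sub>F p in at_right 0. finite (?R C p) \<and> b' * ((1 / p) * ln (1 / p) ^ (2 * ?d)) \<le> real (card (?R C p)) \<and> real (card (?R C p)) \<le> b * ((1 / p) * ln (1 / p) ^ (2 * ?d))"
    by (elim exE conjE) (rule that)
  define E where "E p A \<longleftrightarrow> real (card (subset_sums A \<inter> ?R (1 / C) p)) \<le> p powr (1 / 4) * real (card (?R (1 / C) p)) \<and>
       UNIV - ?R C p \<subseteq> subset_sums A \<and>
       finite (UNIV - subset_sums A) \<and>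
       a / 2 * ((1 / p) * ln (1 / p) ^ (2 * ?d)) \<le> real (card (UNIV - subset_sums A)) \<and>
       real (card (UNIV - subset_sums A)) \<le> b * ((1 / p) * ln (1 / p) ^ (2 * ?d))" for p A
  have small: "\<forall>\<^sub>F p::real in at_right 0. 0 < p \<and> p < 1 \<and> p powr (1 / 4) \<le> 1 / 2"
  proof -
    have "\<forall>\<^sub>F p::real in at_right 0. 0 < p \<and> p < 1" by (rule eventually_small_p[of 0]) auto
    moreover have "\<forall>\<^sub>F p::real in at_right 0. p powr (1 / 4) \<le> 1 / 2" by real_asymp
    ultimately show ?thesis by eventually_elim blast
  qed
  have prob: "\<forall>\<^sub>F p in at_right 0. 1 - (K1 * p ^ 8 + K2 * p powr (1 / 8)) \<le> random_subset_prob p (E p)"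
    using cover sparse lower upper small
  proof eventually_elim
    case (elim p)
    interpret prob_space "coin_flips p :: (nat ^ 'd \<Rightarrow> bool) measure" by (rule prob_space_coin_flips)
    have p: "0 < p" "p < 1" "p powr (1 / 4) \<le> 1 / 2" using elim by auto
    obtain N1 where N1: "N1 \<in> sets (coin_flips p)" "prob N1 \<le> K1 * p ^ 8"
      "\<And>\<omega>. \<omega> \<notin> N1 \<Longrightarrow> UNIV - ?R C1 p \<subseteq> subset_sums {x. \<omega> x}" using elim by blast
    obtain N2 where N2: "N2 \<in> sets (coin_flips p)" "prob N2 \<le> K2 * p powr (1 / 8)"
      "\<And>\<omega>. \<omega> \<notin> N2 \<Longrightarrow> real (card (subset_sums {x. \<omega> x} \<inter> ?R (1 / C) p)) \<le> p powr (1 / 4) * real (card (?R (1 / C) p))"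
      using elim by blast
    have mono: "?R C1 p \<subseteq> ?R C p"
    proof -
      have "C1 * (1 / p) * ln (1 / p) ^ (?d + 1) \<le> C * (1 / p) * ln (1 / p) ^ (?d + 1)"
        using C p by (intro mult_right_mono) auto
      then show ?thesis by (auto simp: region_def)
    qed
    (* The gap lies in the large region, and it contains at least half of the small one because p powr (1 / 4) \<le> 1 / 2. *)
    have good: "E p {x. \<omega> x}" if "\<omega> \<notin> N1 \<union> N2" for \<omega>
    proof -
      let ?S = "subset_sums {x. \<omega> x}" and ?Q = "?R (1 / C) p"
      have S1: "UNIV - ?R C p \<subseteq> ?S" using N1(3) that mono by blast
      have S2: "real (card (?S \<inter> ?Q)) \<le> p powr (1 / 4) * real (card ?Q)" using N2(3) that by blast
      have gap: "UNIV - ?S \<subseteq> ?R C p" using S1 by blast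
      have fin: "finite (UNIV - ?S)" using gap elim by (auto intro: finite_subset)
      have "real (card (UNIV - ?S)) \<le> real (card (?R C p))" using gap elim by (intro of_nat_mono card_mono) auto
      then have up: "real (card (UNIV - ?S)) \<le> b * ((1 / p) * ln (1 / p) ^ (2 * ?d))" using elim by linarith
      have "card ?Q = card (?S \<inter> ?Q) + card (?Q - ?S)"
        using elim card_Int_Diff[of ?Q ?S] by (auto simp: Int_commute)
      moreover have "card (?Q - ?S) \<le> card (UNIV - ?S)" using fin by (intro card_mono) auto
      moreover have "real (card (?S \<inter> ?Q)) \<le> 1 / 2 * real (card ?Q)"
        using S2 p(3) by (rule order_trans[OF _ mult_right_mono]) auto
      ultimately have "real (card ?Q) / 2 \<le> real (card (UNIV - ?S))" by linarith
      then have lo: "a / 2 * ((1 / p) * ln (1 / p) ^ (2 * ?d)) \<le> real (card (UNIV - ?S))"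
        using elim by simp
      show ?thesis unfolding E_def using S1 S2 fin up lo by blast
    qed
    have meas: "{\<omega>. E p {x. \<omega> x}} \<in> sets (coin_flips p)"
    proof -
      have "{\<omega>. E p {x. \<omega> x}} = {\<omega>. finite (UNIV - subset_sums {x. \<omega> x}) \<and>
        (\<lambda>S. real (card (S \<inter> ?R (1 / C) p)) \<le> p powr (1 / 4) * real (card (?R (1 / C) p)) \<and>
          UNIV - ?R C p \<subseteq> S \<and> a / 2 * ((1 / p) * ln (1 / p) ^ (2 * ?d)) \<le> real (card (UNIV - S)) \<and>
          real (card (UNIV - S)) \<le> b * ((1 / p) * ln (1 / p) ^ (2 * ?d))) (subset_sums {x. \<omega> x})}"
        by (auto simp: E_def)
      also have "\<dots> \<in> sets (coin_flips p)" using p by (intro sets_gap_event) auto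
      finally show ?thesis .
    qed
    have "1 - (prob N1 + prob N2) \<le> 1 - prob (N1 \<union> N2)"
      using measure_Un_le[OF N1(1) N2(1)] by simp
    also have "\<dots> = prob (space (coin_flips p) - (N1 \<union> N2))"
      using N1 N2 by (intro prob_compl[symmetric]) auto
    also have "\<dots> \<le> prob {\<omega>. E p {x. \<omega> x}}"
      using meas good by (intro finite_measure_mono) auto
    also have "\<dots> = random_subset_prob p (E p)" by (simp add: random_subset_prob_def)
    finally show ?case using N1(2) N2(2) by linarith
  qed
  have "with_high_probability E"
    unfolding with_high_probability_def
  proof (rule tendsto_sandwich[OF prob])
    show "\<forall>\<^sub>F p in at_right 0. random_subset_prob p (E p) \<le> 1"
      unfolding random_subset_prob_def
      by (intro always_eventually allI prob_space.prob_le_1 prob_space_coin_flips)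
    show "((\<lambda>p. 1 - (K1 * p ^ 8 + K2 * p powr (1 / 8))) \<longlongrightarrow> 1) (at_right 0)"
    proof -
      have "((\<lambda>p::real. p ^ 8) \<longlongrightarrow> 0) (at_right 0)" "((\<lambda>p::real. p powr (1 / 8)) \<longlongrightarrow> 0) (at_right 0)"
        by real_asymp+
      then have "((\<lambda>p. 1 - (K1 * p ^ 8 + K2 * p powr (1 / 8))) \<longlongrightarrow> 1 - (K1 * 0 + K2 * 0)) (at_right 0)"
        by (intro tendsto_intros)
      then show ?thesis by simp
    qed
  qed simp
  moreover have "((\<lambda>p::real. p powr (1 / 4)) \<longlongrightarrow> 0) (at_right 0)" by real_asymp
  ultimately show ?thesis
    using \<open>0 < C\<close> a b unfolding E_def[abs_def]
    by (intro exI[of _ C] conjI exI[of _ "a / 2"] exI[of _ b] exI[of _ "\<lambda>p. p powr (1 / 4)"]) auto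
qed

end
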